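(* For every set $A\in\mathcal{R}$ there is a set $B\in\mathcal{R}(\mathcal{S})$ such that, in any CSG dynamics (i.e. for every admissible sequence of coupling constants $(t_k)_{k\ge 0}$, with associated measure $\mu$ on $(\Omega,\mathcal{R})$), $\mu(A\triangle B)=0$, where $\triangle$ denotes symmetric difference.
   Context: Causets. A causet is a countable (finite or infinite) set with a transitive, irreflexive relation $\prec$ such that every past-set $\{x : x\preceq z\}$ is finite. A stem in a causet is a finite subset $s$ such that $x\prec y\in s$ implies $x\in s$; a finite causet $b$ is said to be a stem in $c$ if $c$ contains a stem isomorphic to $b$ (with the induced order). Spaces. $\tilde\Omega(n)$ is the set of labeled causets on $\{0,\dots,n-1\}$ with natural labeling, i.e. $x\prec y\Rightarrow x<y$. $\tilde\Omega$ is the set of completed (infinite) labeled causets, i.e. causet orders on $\{0,1,2,\dots\}$ with $x\prec y\Rightarrow x<y$. $\Omega$ is the set of completed unlabeled causets, i.e. isomorphism classes of elements of $\tilde\Omega$, and $p:\tilde\Omega\to\Omega$ is the projection to isomorphism classes. $\Omega(\mathbb{N})$ is the set of isomorphism classes of finite causets. $\sigma$-algebras. For $\tilde b\in\tilde\Omega(n)$, the cylinder set $\mathrm{cyl}(\tilde b)$ is the set of $\tilde c\in\tilde\Omega$ whose restriction to $\{0,\dots,n-1\}$ equals $\tilde b$. $\tilde{\mathcal{R}}$ is the $\sigma$-algebra on $\tilde\Omega$ generated by all cylinder sets. $\mathcal{R}=\{A\subset\Omega : p^{-1}(A)\in\tilde{\mathcal{R}}\}$. For $b\in\Omega(\mathbb{N})$,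 $\mathrm{stem}(b)=\{c\in\Omega : c \text{ contains a stem isomorphic to } b\}$; $\mathcal{S}$ is the family of all sets $\mathrm{stem}(b)$, $b\in\Omega(\mathbb{N})$, and $\mathcal{R}(\mathcal{S})$ is the $\sigma$-algebra on $\Omega$ generated by $\mathcal{S}$. Dynamics. A CSG (classical sequential growth) dynamics is given by non-negative reals $t_0,t_1,t_2,\dots$ (coupling constants) with $t_0>0$ and $t_k>0$ for some $k\ge 2$. Put $\lambda(\varpi,m)=\sum_{k=m}^{\varpi}\binom{\varpi-m}{k-m}t_k$. Elements $0,1,2,\dots$ are born in order; given the labeled causet $\tilde c_n\in\tilde\Omega(n)$ already formed, the new element $n$ is placed above exactly the elements of a stem $s\subset\tilde c_n$ with probability $\tau=\lambda(\varpi,m)/\lambda(n,0)$, where $\varpi=|s|$ is the number of ancestors of the new element and $m$ is the number of its parents (maximal elements of $s$). The probability of $\mathrm{cyl}(\tilde b)$ is the product of the transition probabilities $\tau$ of the successive births producing $\tilde b$; this extends uniquely to a probability measure $\tilde\mu$ on $(\tilde\Omega,\tilde{\mathcal{R}})$, and $\mu=\tilde\mu\circ p^{-1}$ on $(\Omega,\mathcal{R})$. *)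

theory Defs
  imports "HOL-Probability.Probability"
begin

section \<open>Causets\<close>

definition causet :: "'a set \<Rightarrow> 'a rel \<Rightarrow> bool" where
  "causet V r \<longleftrightarrow> countable V \<and> r \<subseteq> V \<times> V \<and> trans r \<and> irrefl r \<and>
     (\<forall>z\<in>V. finite {x \<in> V. x = z \<or> (x, z) \<in> r})"

definition causet_iso :: "'a set \<Rightarrow> 'a rel \<Rightarrow> 'b set \<Rightarrow> 'b rel \<Rightarrow> bool" where
  "causet_iso V r W q \<longleftrightarrow>
     (\<exists>f. bij_betw f V W \<and> (\<forall>x\<in>V. \<forall>y\<in>V. (x, y) \<in> r \<longleftrightarrow> (f x, f y) \<in> q))"

definition is_stem :: "'a set \<Rightarrow> 'a rel \<Rightarrow> 'a set \<Rightarrow> bool" where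
  "is_stem V r s \<longleftrightarrow> finite s \<and> s \<subseteq> V \<and> (\<forall>x y. (x, y) \<in> r \<and> y \<in> s \<longrightarrow> x \<in> s)"


section \<open>Labeled and unlabeled causets\<close>

text \<open>A labeled causet is given by its order relation only: the carrier is \<open>{..<n}\<close> for
  \<open>finite_labeled n\<close> and all of \<open>\<nat>\<close> for \<open>labeled\<close>.\<close>

definition natural_labeling :: "nat rel \<Rightarrow> bool" where
  "natural_labeling r \<longleftrightarrow> (\<forall>(x, y) \<in> r. x < y)"

definition finite_labeled :: "nat \<Rightarrow> nat rel set" where
  "finite_labeled n = {b. causet {..<n} b \<and> natural_labeling b}"

definition labeled :: "nat rel set" where
  "labeled = {c. causet UNIV c \<and> natural_labeling c}"

definition labeled_iso :: "nat rel rel" where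
  "labeled_iso = {(c, d). c \<in> labeled \<and> d \<in> labeled \<and> causet_iso UNIV c UNIV d}"

definition unlabeled :: "nat rel set set" where
  "unlabeled = labeled // labeled_iso"

definition iso_class :: "nat rel \<Rightarrow> nat rel set" where
  "iso_class c = labeled_iso `` {c}"

text \<open>Every finite causet is isomorphic to one whose carrier is a finite set of natural numbers.\<close>

definition finite_causets :: "(nat set \<times> nat rel) set" where
  "finite_causets = {(V, r). finite V \<and> causet V r}"

definition finite_iso :: "(nat set \<times> nat rel) rel" where
  "finite_iso = {((V, r), (W, q)). (V, r) \<in> finite_causets \<and> (W, q) \<in> finite_causets \<and>
     causet_iso V r W q}"

definition finite_unlabeled :: "(nat set \<times> nat rel) set set" where
  "finite_unlabeled = finite_causets // finite_iso"


section \<open>The \<open>\<sigma>\<close>-algebras\<close>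

definition cyl :: "nat \<Rightarrow> nat rel \<Rightarrow> nat rel set" where
  "cyl n b = {c \<in> labeled. Restr c {..<n} = b}"

definition labeled_events :: "nat rel set set" where
  "labeled_events = sigma_sets labeled {cyl n b | n b. b \<in> finite_labeled n}"

definition unlabeled_events :: "nat rel set set set" where
  "unlabeled_events = {A. A \<subseteq> unlabeled \<and> iso_class -` A \<inter> labeled \<in> labeled_events}"

text \<open>For an isomorphism class \<open>b\<close>, membership of \<open>(s, Restr r s)\<close> in \<open>b\<close> says that the
  stem \<open>s\<close> with the induced order is isomorphic to \<open>b\<close>.\<close>

definition stem_set :: "(nat set \<times> nat rel) set \<Rightarrow> nat rel set set" where
  "stem_set b = {c \<in> unlabeled. \<exists>r\<in>c. \<exists>s. is_stem UNIV r s \<and> (s, Restr r s) \<in> b}"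

definition stem_events :: "nat rel set set set" where
  "stem_events = sigma_sets unlabeled (stem_set ` finite_unlabeled)"


section \<open>Classical sequential growth\<close>

definition csg_couplings :: "(nat \<Rightarrow> real) \<Rightarrow> bool" where
  "csg_couplings t \<longleftrightarrow> (\<forall>k. 0 \<le> t k) \<and> 0 < t 0 \<and> (\<exists>k\<ge>2. 0 < t k)"

definition csg_lambda :: "(nat \<Rightarrow> real) \<Rightarrow> nat \<Rightarrow> nat \<Rightarrow> real" where
  "csg_lambda t w m = (\<Sum>k=m..w. real ((w - m) choose (k - m)) * t k)"

definition maximal_elements :: "'a rel \<Rightarrow> 'a set \<Rightarrow> 'a set" where
  "maximal_elements r s = {x \<in> s. \<forall>y\<in>s. (x, y) \<notin> r}"

text \<open>The probability that the element \<open>n\<close>, born into the causet \<open>c\<close> on \<open>{..<n}\<close>, is placed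
  above exactly the elements of the stem \<open>s\<close>.\<close>

definition transition_prob :: "(nat \<Rightarrow> real) \<Rightarrow> nat \<Rightarrow> nat rel \<Rightarrow> nat set \<Rightarrow> real" where
  "transition_prob t n c s =
     csg_lambda t (card s) (card (maximal_elements c s)) / csg_lambda t n 0"

definition cyl_prob :: "(nat \<Rightarrow> real) \<Rightarrow> nat \<Rightarrow> nat rel \<Rightarrow> real" where
  "cyl_prob t n b = (\<Prod>i<n. transition_prob t i (Restr b {..<i}) {x. (x, i) \<in> b})"

text \<open>\<open>extend_measure\<close> is the zero measure if no extension exists; that the extension does
  exist, and is unique, is shown in \<open>csg_labeled_measure\<close> and \<open>csg_labeled_measure_unique\<close>.\<close>

definition csg_labeled_measure :: "(nat \<Rightarrow> real) \<Rightarrow> nat rel measure" where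
  "csg_labeled_measure t =
     extend_measure labeled {(n, b). b \<in> finite_labeled n} (\<lambda>(n, b). cyl n b)
       (\<lambda>(n, b). ennreal (cyl_prob t n b))"

definition csg_measure :: "(nat \<Rightarrow> real) \<Rightarrow> nat rel set measure" where
  "csg_measure t = distr (csg_labeled_measure t) (sigma unlabeled unlabeled_events) iso_class"


section \<open>Well-definedness\<close>

lemma equiv_labeled_iso: "equiv labeled labeled_iso"
proof (rule equivI)
  show "labeled_iso \<subseteq> labeled \<times> labeled" by (auto simp: labeled_iso_def)
  show "refl_on labeled labeled_iso"
    by (auto simp: refl_on_def labeled_iso_def causet_iso_def intro!: exI[of _ id])
  show "sym labeled_iso"
  proof (rule symI)
    fix c d assume "(c, d) \<in> labeled_iso"
    then obtain f where *: "c \<in> labeled" "d \<in> labeled" "bij f"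
      "\<forall>x y. (x, y) \<in> c \<longleftrightarrow> (f x, f y) \<in> d"
      by (auto simp: labeled_iso_def causet_iso_def)
    then have "\<forall>x y. (x, y) \<in> d \<longleftrightarrow> (inv f x, inv f y) \<in> c"
      by (simp add: bij_is_surj surj_f_inv_f)
    with * show "(d, c) \<in> labeled_iso"
      by (auto simp: labeled_iso_def causet_iso_def intro!: exI[of _ "inv f"] bij_imp_bij_inv)
  qed
  show "trans labeled_iso"
  proof (rule transI)
    fix c d e assume "(c, d) \<in> labeled_iso" "(d, e) \<in> labeled_iso"
    then obtain f g where "c \<in> labeled" "e \<in> labeled" "bij f" "bij g"
      "\<forall>x y. (x, y) \<in> c \<longleftrightarrow> (f x, f y) \<in> d" "\<forall>x y. (x, y) \<in> d \<longleftrightarrow> (g x, g y) \<in> e"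
      by (auto simp: labeled_iso_def causet_iso_def)
    then show "(c, e) \<in> labeled_iso"
      by (auto simp: labeled_iso_def causet_iso_def intro!: exI[of _ "g \<circ> f"] bij_comp)
  qed
qed

lemma iso_class_in_unlabeled: "c \<in> labeled \<Longrightarrow> iso_class c \<in> unlabeled"
  by (simp add: iso_class_def unlabeled_def quotientI)

lemma cylinders_subset: "{cyl n b | n b. b \<in> finite_labeled n} \<subseteq> Pow labeled"
  by (auto simp: cyl_def)

lemma sigma_algebra_labeled_events: "sigma_algebra labeled labeled_events"
  unfolding labeled_events_def by (rule sigma_algebra_sigma_sets[OF cylinders_subset])

lemma sigma_algebra_unlabeled_events: "sigma_algebra unlabeled unlabeled_events"
proof -
  interpret sigma_algebra labeled labeled_events by (rule sigma_algebra_labeled_events)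
  have compl: "iso_class -` (unlabeled - A) \<inter> labeled = labeled - (iso_class -` A \<inter> labeled)" for A
    using iso_class_in_unlabeled by auto
  have un: "iso_class -` (\<Union>i. A i) \<inter> labeled = (\<Union>i. iso_class -` A i \<inter> labeled)" for A :: "nat \<Rightarrow> _"
    by auto
  show ?thesis
    unfolding sigma_algebra_iff2
  proof (intro conjI ballI allI impI)
    fix A :: "nat \<Rightarrow> nat rel set set" assume "range A \<subseteq> unlabeled_events"
    then have "\<And>i. A i \<subseteq> unlabeled" "\<And>i. iso_class -` A i \<inter> labeled \<in> labeled_events"
      by (auto simp: unlabeled_events_def)
    then show "\<Union> (range A) \<in> unlabeled_events"
      unfolding unlabeled_events_def mem_Collect_eq un by (intro conjI countable_UN) auto
  qed (auto simp: unlabeled_events_def compl)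
qed

lemma sets_csg_measure: "space (csg_measure t) = unlabeled" "sets (csg_measure t) = unlabeled_events"
proof -
  interpret sigma_algebra unlabeled unlabeled_events by (rule sigma_algebra_unlabeled_events)
  show "space (csg_measure t) = unlabeled" "sets (csg_measure t) = unlabeled_events"
    by (simp_all add: csg_measure_def space_measure_of_conv)
qed

lemma cylinders_image:
  "(\<lambda>(n, b). cyl n b) ` {(n, b). b \<in> finite_labeled n} = {cyl n b | n b. b \<in> finite_labeled n}"
  by auto

lemma sets_csg_labeled_measure:
  "space (csg_labeled_measure t) = labeled" "sets (csg_labeled_measure t) = labeled_events"
proof -
  have "(\<lambda>(n, b). cyl n b) ` {(n, b). b \<in> finite_labeled n} \<subseteq> Pow labeled"
    by (auto simp: cyl_def)
  then show "space (csg_labeled_measure t) = labeled"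
    "sets (csg_labeled_measure t) = labeled_events"
    by (simp_all add: csg_labeled_measure_def space_extend_measure sets_extend_measure
        labeled_events_def cylinders_image)
qed

lemma finite_labeledD:
  assumes "b \<in> finite_labeled n"
  shows "(x, y) \<in> b \<Longrightarrow> x < y" "(x, y) \<in> b \<Longrightarrow> y < n" "trans b"
  using assms by (auto simp: finite_labeled_def natural_labeling_def causet_def)

lemma labeledI: "trans c \<Longrightarrow> (\<And>x y. (x, y) \<in> c \<Longrightarrow> x < y) \<Longrightarrow> c \<in> labeled"
proof -
  assume c: "trans c" "\<And>x y. (x, y) \<in> c \<Longrightarrow> x < (y::nat)"
  have "finite {x. x = z \<or> (x, z) \<in> c}" for z
    by (rule finite_subset[of _ "{..z}"]) (use c(2) in \<open>auto intro: less_imp_le\<close>)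
  with c show ?thesis
    by (fastforce simp: labeled_def causet_def natural_labeling_def irrefl_def)
qed

lemma cyl_0: "cyl 0 {} = labeled" "{} \<in> finite_labeled 0"
  by (auto simp: cyl_def finite_labeled_def causet_def natural_labeling_def irrefl_def)

lemma Int_stable_cylinders: "Int_stable (insert {} {cyl n b | n b. b \<in> finite_labeled n})"
proof -
  have *: "cyl n b \<inter> cyl m d = {} \<or> cyl n b \<inter> cyl m d = cyl m d" if "n \<le> m" for n m b d
  proof (cases "Restr d {..<n} = b")
    case True
    with that have "cyl n b \<inter> cyl m d = cyl m d" by (fastforce simp: cyl_def)
    then show ?thesis ..
  next
    case False
    with that have "cyl n b \<inter> cyl m d = {}" by (fastforce simp: cyl_def)
    then show ?thesis ..
  qed
  show ?thesis
  proof (rule Int_stableI)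
    fix X Y
    assume X: "X \<in> insert {} {cyl n b | n b. b \<in> finite_labeled n}"
      and Y: "Y \<in> insert {} {cyl n b | n b. b \<in> finite_labeled n}"
    show "X \<inter> Y \<in> insert {} {cyl n b | n b. b \<in> finite_labeled n}"
    proof (cases "X = {} \<or> Y = {}")
      case False
      with X Y obtain n b m d where XY: "X = cyl n b" "Y = cyl m d" by auto
      have "X \<inter> Y = {} \<or> X \<inter> Y = Y \<or> X \<inter> Y = X"
        using *[of n m b d] *[of m n d b] le_cases[of n m] by (auto simp: XY Int_commute)
      with X Y show ?thesis by auto
    qed auto
  qed
qed

theorem csg_labeled_measure_unique:
  assumes sets: "sets M = labeled_events"
    and cyl: "\<And>n b. b \<in> finite_labeled n \<Longrightarrow> emeasure M (cyl n b) = ennreal (cyl_prob t n b)"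
    and sets': "sets N = labeled_events"
    and cyl': "\<And>n b. b \<in> finite_labeled n \<Longrightarrow> emeasure N (cyl n b) = ennreal (cyl_prob t n b)"
  shows "M = N"
proof (rule measure_eqI_generator_eq[OF Int_stable_cylinders, where \<Omega> = labeled])
  let ?E = "{cyl n b | n b. b \<in> finite_labeled n}"
  have *: "sigma_sets labeled (insert {} ?E) = labeled_events"
    unfolding labeled_events_def
    by (rule sigma_sets_eqI) (auto intro: sigma_sets.Empty)
  show "sets M = sigma_sets labeled (insert {} ?E)" "sets N = sigma_sets labeled (insert {} ?E)"
    by (simp_all add: * sets sets')
  show "insert {} ?E \<subseteq> Pow labeled" by (auto simp: cyl_def)
  show "\<And>X. X \<in> insert {} ?E \<Longrightarrow> emeasure M X = emeasure N X" using cyl cyl' by auto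
  show "range (\<lambda>_::nat. labeled) \<subseteq> insert {} ?E" using cyl_0 by auto
  show "emeasure M labeled \<noteq> \<infinity>" using cyl[OF cyl_0(2)] by (simp add: cyl_0)
qed auto


text \<open>Existence: let each element \<open>n\<close> independently choose a set \<open>K \<subseteq> {..<n}\<close>, with probability
  proportional to \<open>t (card K)\<close>, and place it above the down-closure of \<open>K\<close>.\<close>

lemma sum_card_subsets:
  assumes "finite A"
  shows "(\<Sum>K\<in>Pow A. f (card K)) = (\<Sum>k\<le>card A. real (card A choose k) * f k)"
proof -
  have "(\<Sum>K\<in>Pow A. f (card K)) = (\<Sum>k\<le>card A. \<Sum>K\<in>{K\<in>Pow A. card K = k}. f (card K))"
    by (rule sum.group[symmetric]) (use assms in \<open>auto intro: card_mono\<close>)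
  also have "\<dots> = (\<Sum>k\<le>card A. real (card A choose k) * f k)"
    using n_subsets[OF assms] by (auto intro!: sum.cong simp: Pow_def)
  finally show ?thesis .
qed

lemma sum_card_between:
  assumes "finite s" "m \<subseteq> s"
  shows "(\<Sum>K | m \<subseteq> K \<and> K \<subseteq> s. t (card K)) = csg_lambda t (card s) (card m)"
proof -
  have fm: "finite m" "finite (s - m)" using assms finite_subset by auto
  have cs: "card (s - m) = card s - card m" "card m \<le> card s"
    using assms fm by (auto simp: card_Diff_subset card_mono)
  have "(\<Sum>K | m \<subseteq> K \<and> K \<subseteq> s. t (card K)) = (\<Sum>J\<in>Pow (s - m). t (card m + card J))"
  proof (rule sum.reindex_bij_witness[of _ "\<lambda>J. m \<union> J" "\<lambda>K. K - m"])
    fix K assume K: "K \<in> {K. m \<subseteq> K \<and> K \<subseteq> s}"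
    then have "finite K" using assms finite_subset by auto
    with K fm show "t (card m + card (K - m)) = t (card K)"
      by (simp add: card_Diff_subset card_mono)
  qed (use assms in auto)
  also have "\<dots> = (\<Sum>j\<le>card s - card m. real (card s - card m choose j) * t (card m + j))"
    using sum_card_subsets[OF fm(2), of "\<lambda>j. t (card m + j)"] cs by simp
  also have "\<dots> = csg_lambda t (card s) (card m)"
    unfolding csg_lambda_def
    by (rule sum.reindex_bij_witness[of _ "\<lambda>k. k - card m" "\<lambda>j. card m + j"]) (use cs in auto)
  finally show ?thesis .
qed

lemma csg_lambda_0: "csg_lambda t n 0 = (\<Sum>K\<in>Pow {..<n}. t (card K))"
  using sum_card_between[of "{..<n}" "{}" t] by (simp add: Pow_def)

lemma csg_lambda_0_pos: "csg_couplings t \<Longrightarrow> 0 < csg_lambda t n 0"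
  unfolding csg_lambda_0
  by (rule sum_pos2[of _ "{}"]) (auto simp: csg_couplings_def)

lemma csg_lambda_nonneg: "csg_couplings t \<Longrightarrow> 0 \<le> csg_lambda t w m"
  by (auto simp: csg_lambda_def csg_couplings_def intro!: sum_nonneg)

definition down_closure :: "nat rel \<Rightarrow> nat set \<Rightarrow> nat set" where
  "down_closure b K = K \<union> {x. \<exists>k\<in>K. (x, k) \<in> b}"

lemma down_closure_eq_iff:
  assumes b: "b \<in> finite_labeled n"
  shows "down_closure b K = {x. (x, i) \<in> b} \<longleftrightarrow>
    maximal_elements (Restr b {..<i}) {x. (x, i) \<in> b} \<subseteq> K \<and> K \<subseteq> {x. (x, i) \<in> b}"
    (is "_ = ?s \<longleftrightarrow> ?m \<subseteq> K \<and> _")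
proof safe
  note D = finite_labeledD[OF b]
  {
    fix x assume K: "down_closure b K = ?s" and x: "x \<in> ?m"
    show "x \<in> K"
    proof (rule ccontr)
      assume "x \<notin> K"
      moreover have "x \<in> down_closure b K" using K x by (auto simp: maximal_elements_def)
      ultimately obtain k where k: "k \<in> K" "(x, k) \<in> b" by (auto simp: down_closure_def)
      then have "(k, i) \<in> b" using K by (auto simp: down_closure_def)
      with k x D(1)[of x k] D(1)[of k i] show False by (auto simp: maximal_elements_def)
    qed
  next
    fix x assume "down_closure b K = ?s" "x \<in> K"
    then show "(x, i) \<in> b" by (auto simp: down_closure_def)
  next
    fix x assume "?m \<subseteq> K" "K \<subseteq> ?s" "x \<in> down_closure b K"
    then show "(x, i) \<in> b" using D(3) by (auto simp: down_closure_def dest: transD)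
  next
    fix x assume m: "?m \<subseteq> K" and "(x, i) \<in> b"
    then show "x \<in> down_closure b K"
    proof (induction "i - x" arbitrary: x rule: less_induct)
      case less
      show ?case
      proof (cases "x \<in> ?m")
        case True
        with m show ?thesis by (auto simp: down_closure_def)
      next
        case False
        with less.prems(2) obtain y where y: "(y, i) \<in> b" "(x, y) \<in> b"
          by (auto simp: maximal_elements_def)
        then have "y \<in> down_closure b K"
          using less.hyps[of y] m D(1)[of x y] D(1)[of y i] by auto
        then show ?thesis
          using y(2) D(3) by (auto simp: down_closure_def dest: transD)
      qed
    qed
  }
qed

definition choice_measure :: "(nat \<Rightarrow> real) \<Rightarrow> nat \<Rightarrow> nat set measure" where
  "choice_measure t n = point_measure (Pow {..<n}) (\<lambda>K. ennreal (t (card K) / csg_lambda t n 0))"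

definition choice_causet :: "(nat \<Rightarrow> nat set) \<Rightarrow> nat rel" where
  "choice_causet w = {(k, n). k \<in> w n \<and> k < n}\<^sup>+"

lemma emeasure_choice_measure:
  assumes t: "csg_couplings t" and X: "X \<subseteq> Pow {..<n}"
  shows "emeasure (choice_measure t n) X = ennreal ((\<Sum>K\<in>X. t (card K)) / csg_lambda t n 0)"
proof -
  have "emeasure (choice_measure t n) X = (\<Sum>K\<in>X. ennreal (t (card K) / csg_lambda t n 0))"
    unfolding choice_measure_def using X by (simp add: emeasure_point_measure_finite)
  also have "\<dots> = ennreal (\<Sum>K\<in>X. t (card K) / csg_lambda t n 0)"
    using t csg_lambda_0_pos[OF t, of n]
    by (intro sum_ennreal) (auto simp: csg_couplings_def intro!: divide_nonneg_nonneg)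
  finally show ?thesis by (simp add: sum_divide_distrib)
qed

lemma space_choice_measure: "space (choice_measure t n) = Pow {..<n}"
  and sets_choice_measure: "sets (choice_measure t n) = Pow (Pow {..<n})"
  by (simp_all add: choice_measure_def space_point_measure sets_point_measure)

lemma prob_space_choice_measure: "csg_couplings t \<Longrightarrow> prob_space (choice_measure t n)"
  using csg_lambda_0_pos[of t n]
  by (intro prob_spaceI)
     (simp add: space_choice_measure emeasure_choice_measure csg_lambda_0[symmetric])

lemma choice_causet_less: "(x, y) \<in> choice_causet w \<Longrightarrow> x < y"
  unfolding choice_causet_def by (induction rule: trancl_induct) auto

lemma choice_causet_labeled: "choice_causet w \<in> labeled"
proof (rule labeledI)
  show "trans (choice_causet w)" by (simp add: choice_causet_def)
qed (rule choice_causet_less)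

lemma choice_causet_past:
  assumes "w i \<subseteq> {..<i}"
  shows "{x. (x, i) \<in> choice_causet w} = down_closure (choice_causet w) (w i)"
proof -
  let ?g = "{(k, n). k \<in> w n \<and> k < n}"
  have "(x, i) \<in> ?g\<^sup>+ \<longleftrightarrow> x \<in> w i \<or> (\<exists>k\<in>w i. (x, k) \<in> ?g\<^sup>+)" for x
  proof -
    have "(x, i) \<in> ?g\<^sup>+ \<longleftrightarrow> (\<exists>k. (x, k) \<in> ?g\<^sup>* \<and> (k, i) \<in> ?g)"
      by (meson rtrancl_into_trancl1 tranclD2)
    with assms show ?thesis by (auto simp: rtrancl_eq_or_trancl)
  qed
  then show ?thesis by (auto simp: choice_causet_def down_closure_def)
qed

lemma choice_causet_cyl_iff:
  assumes b: "b \<in> finite_labeled n" and w: "\<And>i. w i \<subseteq> {..<i}"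
  shows "choice_causet w \<in> cyl n b \<longleftrightarrow> (\<forall>i<n. down_closure b (w i) = {x. (x, i) \<in> b})"
    (is "?L \<longleftrightarrow> ?R")
proof -
  let ?c = "choice_causet w"
  note D = finite_labeledD[OF b]
  have L: "?L \<longleftrightarrow> (\<forall>i<n. {x. (x, i) \<in> ?c} = {x. (x, i) \<in> b})"
  proof -
    have "?L \<longleftrightarrow> Restr ?c {..<n} = b" by (simp add: cyl_def choice_causet_labeled)
    also have "\<dots> \<longleftrightarrow> (\<forall>i<n. {x. (x, i) \<in> ?c} = {x. (x, i) \<in> b})"
    proof (intro iffI allI impI)
      fix i assume "Restr ?c {..<n} = b" "i < n"
      then show "{x. (x, i) \<in> ?c} = {x. (x, i) \<in> b}"
        using choice_causet_less[of _ i w] by fastforce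
    next
      assume *: "\<forall>i<n. {x. (x, i) \<in> ?c} = {x. (x, i) \<in> b}"
      have "(x, i) \<in> Restr ?c {..<n} \<longleftrightarrow> (x, i) \<in> b" for x i
      proof (cases "i < n")
        case True
        with * have "(x, i) \<in> ?c \<longleftrightarrow> (x, i) \<in> b" by blast
        with True D(1)[of x i] show ?thesis by auto
      qed (use D(2)[of x i] in auto)
      then show "Restr ?c {..<n} = b" by auto
    qed
    finally show ?thesis .
  qed
  have cong: "down_closure ?c (w i) = down_closure b (w i)"
    if "\<forall>k<i. {x. (x, k) \<in> ?c} = {x. (x, k) \<in> b}" for i
    using that w[of i] unfolding down_closure_def by blast
  show ?thesis
  proof
    assume ?L
    then have *: "\<forall>i<n. {x. (x, i) \<in> ?c} = {x. (x, i) \<in> b}" using L by simp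
    show ?R
    proof (intro allI impI)
      fix i assume "i < n"
      then show "down_closure b (w i) = {x. (x, i) \<in> b}"
        using * cong[of i] choice_causet_past[of w i, OF w] by auto
    qed
  next
    assume R: ?R
    have "{x. (x, i) \<in> ?c} = {x. (x, i) \<in> b}" if "i < n" for i
      using that
    proof (induction i rule: less_induct)
      case (less i)
      then have "down_closure ?c (w i) = down_closure b (w i)" by (intro cong) auto
      with R less.prems show ?case using choice_causet_past[of w i, OF w] by auto
    qed
    then show ?L using L by simp
  qed
qed

theorem csg_labeled_measure_exists:
  assumes t: "csg_couplings t"
  shows "\<exists>M. prob_space M \<and> space M = labeled \<and> sets M = labeled_events \<and>
    (\<forall>n. \<forall>b\<in>finite_labeled n. emeasure M (cyl n b) = ennreal (cyl_prob t n b))"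
proof -
  let ?C = "choice_measure t"
  let ?P = "PiM UNIV ?C"
  let ?E = "{cyl n b | n b. b \<in> finite_labeled n}"
  let ?L = "sigma labeled ?E"
  interpret C: prob_space "?C i" for i by (rule prob_space_choice_measure[OF t])
  interpret P: product_prob_space ?C UNIV ..
  have L: "space ?L = labeled" "sets ?L = labeled_events"
    using cylinders_subset by (simp_all add: labeled_events_def space_measure_of_conv)
  define X where "X b i = {K. maximal_elements (Restr b {..<i}) {x. (x, i) \<in> b} \<subseteq> K \<and>
    K \<subseteq> {x. (x, i) \<in> b}}" for b :: "nat rel" and i
  have X: "X b i \<subseteq> Pow {..<i}" if "b \<in> finite_labeled n" for b n i
    using finite_labeledD[OF that] by (auto simp: X_def)
  have vim: "choice_causet -` cyl n b \<inter> space ?P = {w \<in> space ?P. \<forall>i\<in>{..<n}. w i \<in> X b i}"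
    if b: "b \<in> finite_labeled n" for n b
  proof -
    have "choice_causet w \<in> cyl n b \<longleftrightarrow> (\<forall>i\<in>{..<n}. w i \<in> X b i)" if "w \<in> space ?P" for w
    proof -
      have "\<And>i. w i \<subseteq> {..<i}" using that by (auto simp: space_PiM space_choice_measure)
      from choice_causet_cyl_iff[OF b this] show ?thesis
        by (simp add: X_def down_closure_eq_iff[OF b] Ball_def)
    qed
    then show ?thesis by auto
  qed
  have meas: "choice_causet \<in> measurable ?P ?L"
  proof (rule measurable_measure_of[OF cylinders_subset])
    show "choice_causet \<in> space ?P \<rightarrow> labeled" using choice_causet_labeled by auto
    fix Y assume "Y \<in> ?E"
    then obtain n b where b: "b \<in> finite_labeled n" and Y: "Y = cyl n b" by auto
    have "{w \<in> space ?P. w i \<in> X b i} \<in> sets ?P" for i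
      by (rule measurable_sets_Collect[where M = "?P" and N = "?C i", OF measurable_component_singleton])
         (use X[OF b, of i] in \<open>auto simp: space_choice_measure sets_choice_measure\<close>)
    then show "choice_causet -` Y \<inter> space ?P \<in> sets ?P"
      unfolding Y vim[OF b] by (intro sets.sets_Collect_finite_All) auto
  qed
  let ?M = "distr ?P ?L choice_causet"
  have "emeasure ?M (cyl n b) = ennreal (cyl_prob t n b)" if b: "b \<in> finite_labeled n" for n b
  proof -
    have "cyl n b \<in> sets ?L" unfolding L labeled_events_def using b by blast
    then have "emeasure ?M (cyl n b) = emeasure ?P {w \<in> space ?P. \<forall>i\<in>{..<n}. w i \<in> X b i}"
      using meas vim[OF b] by (simp add: emeasure_distr)
    also have "\<dots> = (\<Prod>i<n. emeasure (?C i) (X b i))"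
      by (rule P.emeasure_PiM_Collect) (use X[OF b] in \<open>auto simp: sets_choice_measure\<close>)
    also have "\<dots> = (\<Prod>i<n. ennreal (transition_prob t i (Restr b {..<i}) {x. (x, i) \<in> b}))"
    proof (rule prod.cong)
      fix i
      have fin: "finite {x. (x, i) \<in> b}"
        by (rule finite_subset[of _ "{..<i}"]) (use finite_labeledD(1)[OF b] in auto)
      have "(\<Sum>K\<in>X b i. t (card K)) =
          csg_lambda t (card {x. (x, i) \<in> b})
            (card (maximal_elements (Restr b {..<i}) {x. (x, i) \<in> b}))"
        unfolding X_def by (rule sum_card_between[OF fin]) (auto simp: maximal_elements_def)
      then show "emeasure (?C i) (X b i) =
          ennreal (transition_prob t i (Restr b {..<i}) {x. (x, i) \<in> b})"
        by (simp add: emeasure_choice_measure[OF t X[OF b]] transition_prob_def)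
    qed simp
    also have "\<dots> = ennreal (cyl_prob t n b)"
      unfolding cyl_prob_def using csg_lambda_nonneg[OF t]
      by (intro prod_ennreal) (auto simp: transition_prob_def)
    finally show ?thesis .
  qed
  moreover have "prob_space ?M" by (rule P.prob_space_distr[OF meas])
  ultimately show ?thesis using L by (intro exI[of _ ?M]) auto
qed

theorem csg_labeled_measure:
  assumes t: "csg_couplings t"
  shows "prob_space (csg_labeled_measure t)"
    and "b \<in> finite_labeled n \<Longrightarrow>
      emeasure (csg_labeled_measure t) (cyl n b) = ennreal (cyl_prob t n b)"
proof -
  obtain M where M: "prob_space M" "space M = labeled" "sets M = labeled_events"
    "\<And>n b. b \<in> finite_labeled n \<Longrightarrow> emeasure M (cyl n b) = ennreal (cyl_prob t n b)"
    using csg_labeled_measure_exists[OF t] by (elim exE conjE) simp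
  have *: "emeasure (csg_labeled_measure t) (cyl n b) = ennreal (cyl_prob t n b)"
    if "b \<in> finite_labeled n" for n b
  proof (rule emeasure_extend_measure_Pair[OF csg_labeled_measure_def[of t],
        where \<mu>' = "emeasure M"])
    show "positive (sets (csg_labeled_measure t)) (emeasure M)"
      "countably_additive (sets (csg_labeled_measure t)) (emeasure M)"
      by (simp_all add: sets_csg_labeled_measure M(3)[symmetric] emeasure_positive
          emeasure_countably_additive)
  qed (use M that in \<open>auto simp: cyl_def\<close>)
  then show "b \<in> finite_labeled n \<Longrightarrow>
      emeasure (csg_labeled_measure t) (cyl n b) = ennreal (cyl_prob t n b)" .
  have "csg_labeled_measure t = M"
    by (rule csg_labeled_measure_unique[where t = t])
       (use * M in \<open>auto simp: sets_csg_labeled_measure\<close>)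
  with M show "prob_space (csg_labeled_measure t)" by simp
qed

lemma iso_class_measurable: "iso_class \<in> measurable (csg_labeled_measure t) (csg_measure t)"
  by (rule measurableI)
     (auto simp: sets_csg_labeled_measure sets_csg_measure iso_class_in_unlabeled unlabeled_events_def)

end

theory Submission
  imports Defs
begin

text \<open>
  Let \<open>layer c j\<close> consist of the elements of \<open>c\<close> of height less than \<open>j\<close>. Almost surely every layer is
  finite: the probability that the past of \<open>n\<close> is contained in a fixed finite set is at most a
  constant divided by \<open>csg_lambda t n 0\<close>, which grows at least quadratically, so the
  Borel-Cantelli lemma applies.

  A causet with finite layers is determined up to isomorphism by its stems. Indeed \<open>layer c j\<close> is
  the largest stem of height at most \<open>j\<close>, so its isomorphism type is a stem event, and by
  Koenig's lemma the isomorphism types of all layers determine the causet. From these types one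
  builds, layer by layer and measurably with respect to the stem events, a canonical labeling of
  \<open>c\<close>. Pulling the event \<open>A\<close> back along the canonical labeling gives a stem event \<open>B\<close> that agrees with
  \<open>A\<close> on all causets with finite layers, regardless of the couplings.
\<close>

section \<open>Layers\<close>

text \<open>The carrier is not an argument: a point without predecessors, in particular one outside
  the field of \<open>r\<close>, lies in every layer except layer 0. Statements about a causet on
  \<open>V\<close> therefore intersect the layers with \<open>V\<close> or ask for
  \<open>V \<subseteq> layer q j\<close>.\<close>

primrec layer :: "'a rel \<Rightarrow> nat \<Rightarrow> 'a set" where
  "layer r 0 = {}"
| "layer r (Suc j) = {x. \<forall>y. (y, x) \<in> r \<longrightarrow> y \<in> layer r j}"

lemma layer_mono_Suc: "layer r j \<subseteq> layer r (Suc j)"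
  by (induction j) auto

lemma layer_mono: "i \<le> j \<Longrightarrow> layer r i \<subseteq> layer r j"
  by (rule lift_Suc_mono_le[of "layer r"]) (rule layer_mono_Suc)

lemma layer_down_closed: "(y, x) \<in> r \<Longrightarrow> x \<in> layer r j \<Longrightarrow> y \<in> layer r j"
  using layer_mono_Suc[of r] by (cases j) auto

text \<open>Going down from \<open>x\<close> the labels strictly decrease, so at most
  \<open>x\<close> elements can follow below it in a chain.\<close>

lemma layer_exhausts:
  assumes "\<And>x y. (x, y) \<in> r \<Longrightarrow> x < (y::nat)"
  shows "x \<in> layer r (Suc x)"
proof (induction x rule: less_induct)
  case (less x)
  have "y \<in> layer r x" if "(y, x) \<in> r" for y
    using less[of y] assms[OF that] layer_mono[of "Suc y" x r] by auto
  then show ?case by simp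
qed

text \<open>Membership in a layer depends only on the past of a point. As \<open>V\<close> and
  \<open>W\<close> contain the pasts of their points, an isomorphism between them suffices, although
  the layers are taken in the full relations \<open>r\<close> and \<open>q\<close>.\<close>

lemma layer_iso:
  assumes f: "bij_betw f V W" "\<And>x y. x \<in> V \<Longrightarrow> y \<in> V \<Longrightarrow> (x, y) \<in> r \<longleftrightarrow> (f x, f y) \<in> q"
    and V: "\<And>x y. (x, y) \<in> r \<Longrightarrow> y \<in> V \<Longrightarrow> x \<in> V"
    and W: "\<And>x y. (x, y) \<in> q \<Longrightarrow> y \<in> W \<Longrightarrow> x \<in> W"
  shows "x \<in> V \<Longrightarrow> f x \<in> layer q j \<longleftrightarrow> x \<in> layer r j"
proof (induction j arbitrary: x)
  case (Suc j)
  have fW: "f y \<in> W" if "y \<in> V" for y using f(1) that by (auto simp: bij_betw_def)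
  have "(\<forall>z. (z, f x) \<in> q \<longrightarrow> z \<in> layer q j) \<longleftrightarrow> (\<forall>y. (y, x) \<in> r \<longrightarrow> y \<in> layer r j)"
  proof safe
    fix y assume "\<forall>z. (z, f x) \<in> q \<longrightarrow> z \<in> layer q j" and y: "(y, x) \<in> r"
    then show "y \<in> layer r j" using V[OF y] f(2)[of y x] Suc by auto
  next
    fix z assume *: "\<forall>y. (y, x) \<in> r \<longrightarrow> y \<in> layer r j" and z: "(z, f x) \<in> q"
    obtain y where "y \<in> V" "z = f y"
      using W[OF z] fW[OF Suc.prems] f(1) by (auto simp: bij_betw_def)
    then show "z \<in> layer q j" using z * f(2)[of y x] Suc by auto
  qed
  then show ?case by simp
qed simp

lemma causet_iso_layer:
  assumes "causet_iso V r W q"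
    and "\<And>x y. (x, y) \<in> r \<Longrightarrow> y \<in> V \<Longrightarrow> x \<in> V"
    and "\<And>x y. (x, y) \<in> q \<Longrightarrow> y \<in> W \<Longrightarrow> x \<in> W"
  shows "causet_iso (V \<inter> layer r j) r (W \<inter> layer q j) q"
proof -
  obtain f where f: "bij_betw f V W"
    "\<And>x y. x \<in> V \<Longrightarrow> y \<in> V \<Longrightarrow> (x, y) \<in> r \<longleftrightarrow> (f x, f y) \<in> q"
    using assms(1) unfolding causet_iso_def by blast
  have L: "f x \<in> layer q j \<longleftrightarrow> x \<in> layer r j" if "x \<in> V" for x
    by (rule layer_iso[OF f(1)]) (use that f(2) assms(2,3) in blast)+
  have "bij_betw f (V \<inter> layer r j) (f ` (V \<inter> layer r j))"
    using f(1) by (auto simp: bij_betw_def inj_on_def)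
  moreover have "f ` (V \<inter> layer r j) = W \<inter> layer q j"
    using f(1) L by (fastforce simp: bij_betw_def)
  ultimately show ?thesis using f(2) by (auto simp: causet_iso_def intro!: exI[of _ f])
qed

section \<open>Isomorphisms and their gluing along layers\<close>

lemma causet_iso_refl: "causet_iso V r V r"
  by (auto simp: causet_iso_def intro!: exI[of _ id])

lemma causet_iso_sym: "causet_iso V r W q \<Longrightarrow> causet_iso W q V r"
proof -
  assume "causet_iso V r W q"
  then obtain f where f: "bij_betw f V W" "\<forall>x\<in>V. \<forall>y\<in>V. (x, y) \<in> r \<longleftrightarrow> (f x, f y) \<in> q"
    unfolding causet_iso_def by blast
  let ?g = "the_inv_into V f"
  have "bij_betw ?g W V" by (rule bij_betw_the_inv_into[OF f(1)])
  moreover have "(x, y) \<in> q \<longleftrightarrow> (?g x, ?g y) \<in> r" if "x \<in> W" "y \<in> W" for x y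
    using f that bij_betw_apply[OF \<open>bij_betw ?g W V\<close>]
    by (simp add: f_the_inv_into_f_bij_betw)
  ultimately show ?thesis by (auto simp: causet_iso_def)
qed

lemma causet_iso_trans: "causet_iso V r W q \<Longrightarrow> causet_iso W q U p \<Longrightarrow> causet_iso V r U p"
proof -
  assume "causet_iso V r W q" "causet_iso W q U p"
  then obtain f g where f: "bij_betw f V W" "\<forall>x\<in>V. \<forall>y\<in>V. (x, y) \<in> r \<longleftrightarrow> (f x, f y) \<in> q"
    and g: "bij_betw g W U" "\<forall>x\<in>W. \<forall>y\<in>W. (x, y) \<in> q \<longleftrightarrow> (g x, g y) \<in> p"
    unfolding causet_iso_def by blast
  then show ?thesis
    using bij_betw_apply[OF f(1)] bij_betw_trans[OF f(1) g(1)]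
    by (auto simp: causet_iso_def intro!: exI[of _ "g \<circ> f"])
qed

lemma causet_iso_card: "causet_iso V r W q \<Longrightarrow> card V = card W"
  by (auto simp: causet_iso_def bij_betw_same_card)

lemma causet_iso_finite: "causet_iso V r W q \<Longrightarrow> finite V \<longleftrightarrow> finite W"
  by (auto simp: causet_iso_def bij_betw_finite)

lemma causet_iso_Restr: "causet_iso V (Restr r V) W q \<longleftrightarrow> causet_iso V r W q"
  by (auto simp: causet_iso_def)

lemma causet_iso_Restr': "causet_iso V q W (Restr r W) \<longleftrightarrow> causet_iso V q W r"
  by (metis causet_iso_Restr causet_iso_sym)

text \<open>Koenig's lemma for a tree of maps: the nodes of level \<open>j\<close> are the members
  of \<open>I j\<close>, and restriction to \<open>L i\<close> leads down to level \<open>i\<close>.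
  The branch runs through nodes that have extensions on infinitely many levels. Members of
  \<open>I j\<close> are not assumed extensional, so coherence compares restrictions on both
  sides.\<close>

lemma koenig_restrict:
  fixes I :: "nat \<Rightarrow> ('a \<Rightarrow> 'b) set"
  assumes fin: "\<And>j. finite (I j)" and ne: "\<And>j. I j \<noteq> {}"
    and L: "\<And>i j. i \<le> j \<Longrightarrow> L i \<subseteq> L j"
    and restr: "\<And>i j f. i \<le> j \<Longrightarrow> f \<in> I j \<Longrightarrow> restrict f (L i) \<in> I i"
  obtains F where "\<And>j. F j \<in> I j" "\<And>i j. i \<le> j \<Longrightarrow> restrict (F j) (L i) = restrict (F i) (L i)"
proof -
  define good where "good j f \<longleftrightarrow> f \<in> I j \<and> (\<exists>\<^sub>\<infinity>k. \<exists>g\<in>I k. j \<le> k \<and> restrict g (L j) = f)" for j f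
  \<comment> \<open>The predicate \<open>P\<close> lets one pigeonhole argument serve twice: it is
    trivial for the root and demands agreement with the previous node for a successor. The
    infinitely many levels in \<open>K\<close> give only finitely many restrictions to
    \<open>L j\<close>, so one of them occurs infinitely often, and that one is good.\<close>
  have extend: "\<exists>f'. good j f' \<and> P f'"
    if inf: "\<exists>\<^sub>\<infinity>k. \<exists>g\<in>I k. j \<le> k \<and> P (restrict g (L j))" for j P
  proof -
    define K where "K = {k. \<exists>g\<in>I k. j \<le> k \<and> P (restrict g (L j))}"
    have "\<forall>k\<in>K. \<exists>g. g \<in> I k \<and> j \<le> k \<and> P (restrict g (L j))" by (auto simp: K_def)
    then obtain g where g: "\<And>k. k \<in> K \<Longrightarrow> g k \<in> I k \<and> j \<le> k \<and> P (restrict (g k) (L j))"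
      by metis
    have "infinite K" using inf by (simp add: K_def INFM_iff_infinite)
    moreover have sub: "(\<lambda>k. restrict (g k) (L j)) ` K \<subseteq> I j" using g restr by auto
    ultimately obtain k0 where k0: "k0 \<in> K"
      and inf': "infinite {k \<in> K. restrict (g k) (L j) = restrict (g k0) (L j)}"
      using pigeonhole_infinite[of K "\<lambda>k. restrict (g k) (L j)"] finite_subset[OF sub fin] by blast
    have "infinite {k. \<exists>h\<in>I k. j \<le> k \<and> restrict h (L j) = restrict (g k0) (L j)}"
      by (rule infinite_super[OF _ inf']) (use g in auto)
    then show ?thesis
      using g[OF k0] restr by (intro exI[of _ "restrict (g k0) (L j)"])
        (auto simp: good_def INFM_iff_infinite)
  qed
  have "\<exists>\<^sub>\<infinity>k. \<exists>g\<in>I k. 0 \<le> k" using ne by (auto simp: INFM_nat ex_in_conv)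
  then have "\<exists>f. good 0 f" using extend[of 0 "\<lambda>_. True"] by simp
  moreover have "\<exists>f'. good (Suc j) f' \<and> restrict f' (L j) = restrict f (L j)" if "good j f" for j f
  proof -
    have inf: "\<exists>\<^sub>\<infinity>k. \<exists>g\<in>I k. j \<le> k \<and> restrict g (L j) = f" using that by (simp add: good_def)
    have "\<exists>\<^sub>\<infinity>k. \<exists>g\<in>I k. Suc j \<le> k \<and> restrict (restrict g (L (Suc j))) (L j) = restrict f (L j)"
    proof -
      have "restrict g (L j) = f \<Longrightarrow>
          restrict (restrict g (L (Suc j))) (L j) = restrict f (L j)" for g
        using L[of j "Suc j"] by (auto simp: restrict_restrict Int_absorb1 Int_absorb2)
      moreover have "\<exists>\<^sub>\<infinity>k. (\<exists>g\<in>I k. j \<le> k \<and> restrict g (L j) = f) \<and> Suc j \<le> k"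
        using inf by (auto simp: INFM_nat) (metis Suc_leI less_trans max_less_iff_conj lessI)
      ultimately show ?thesis by (auto elim!: INFM_mono)
    qed
    from extend[OF this] show ?thesis by blast
  qed
  ultimately obtain F where F: "\<And>j. good j (F j)"
    "\<And>j. restrict (F (Suc j)) (L j) = restrict (F j) (L j)"
    using dependent_nat_choice[of good "\<lambda>j f f'. restrict f' (L j) = restrict f (L j)"] by metis
  have "restrict (F j) (L i) = restrict (F i) (L i)" if "i \<le> j" for i j
    using that
  proof (induction j rule: dec_induct)
    case (step j)
    have "restrict (F (Suc j)) (L i) = restrict (restrict (F (Suc j)) (L j)) (L i)"
      using L[OF step(1)] by (simp add: restrict_restrict Int_absorb1)
    also have "\<dots> = restrict (F j) (L i)"
      using L[OF step(1)] unfolding F(2) by (simp add: restrict_restrict Int_absorb1)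
    finally show ?case using step by simp
  qed simp
  moreover have "F j \<in> I j" for j using F(1) by (simp add: good_def)
  ultimately show thesis by (rule that[rotated])
qed

text \<open>The given isomorphisms of the layers need not fit together. But each of them restricts
  to isomorphisms of all lower layers, and a finite layer admits only finitely many, so Koenig's
  lemma yields a coherent family whose union is an isomorphism.\<close>

lemma causet_iso_of_layers:
  assumes fin: "\<And>j. finite (layer r j)"
    and exh: "(\<Union>j. layer r j) = UNIV" "(\<Union>j. layer q j) = UNIV"
    and iso: "\<And>j. causet_iso (layer r j) r (layer q j) q"
  shows "causet_iso UNIV r UNIV q"
proof -
  \<comment> \<open>Extensionality removes the freedom outside the layer and so makes
    \<open>I j\<close> finite.\<close>
  define I where "I j = {f \<in> extensional (layer r j). bij_betw f (layer r j) (layer q j) \<and>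
    (\<forall>x\<in>layer r j. \<forall>y\<in>layer r j. (x, y) \<in> r \<longleftrightarrow> (f x, f y) \<in> q)}" for j
  have fin': "finite (layer q j)" for j using causet_iso_finite[OF iso[of j]] fin by simp
  have finI: "finite (I j)" for j
    by (rule finite_subset[OF _ finite_PiE[OF fin[of j], of "\<lambda>_. layer q j"]])
       (use fin' in \<open>auto simp: I_def PiE_def bij_betw_def\<close>)
  have restrI: "restrict f (layer r j) \<in> I j"
    if f: "bij_betw f (layer r k) (layer q k)"
      "\<And>x y. x \<in> layer r k \<Longrightarrow> y \<in> layer r k \<Longrightarrow> (x, y) \<in> r \<longleftrightarrow> (f x, f y) \<in> q"
      and jk: "j \<le> k" for f j k
  proof -
    have L: "f x \<in> layer q j \<longleftrightarrow> x \<in> layer r j" if "x \<in> layer r k" for x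
      by (rule layer_iso[OF f(1)]) (fact f(2) that | erule (1) layer_down_closed)+
    have "f ` layer r j = layer q j"
      using f(1) L layer_mono[OF jk, of r] layer_mono[OF jk, of q]
      by (fastforce simp: bij_betw_def)
    moreover have "inj_on f (layer r j)"
      using f(1) layer_mono[OF jk, of r] by (auto simp: bij_betw_def intro: inj_on_subset)
    ultimately show ?thesis
      using f(2) layer_mono[OF jk, of r]
      by (auto simp: I_def bij_betw_def inj_on_def subset_iff)
  qed
  have ne: "I j \<noteq> {}" for j
    using iso[of j] restrI[OF _ _ order_refl, of _ j] unfolding causet_iso_def by blast
  have restrI': "restrict f (layer r j) \<in> I j" if "j \<le> k" "f \<in> I k" for f j k
    by (rule restrI) (use that in \<open>auto simp: I_def\<close>)
  have "\<exists>F. (\<forall>j. F j \<in> I j) \<and>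
      (\<forall>i j. i \<le> j \<longrightarrow> restrict (F j) (layer r i) = restrict (F i) (layer r i))"
    by (rule koenig_restrict[of I "layer r", OF finI ne])
       (erule layer_mono | erule (1) restrI' | blast)+
  then obtain F where F: "\<And>j. F j \<in> I j"
    "\<And>i j. i \<le> j \<Longrightarrow> restrict (F j) (layer r i) = restrict (F i) (layer r i)"
    by blast
  \<comment> \<open>By coherence every layer that contains \<open>x\<close> gives the same value;
    the least one is just a definite choice.\<close>
  define h where "h x = (LEAST j. x \<in> layer r j)" for x
  define f where "f x = F (h x) x" for x
  have f: "f x = F j x" if "x \<in> layer r j" for x j
  proof -
    have "x \<in> layer r (h x)" "h x \<le> j" using that by (auto simp: h_def intro: LeastI Least_le)
    then show ?thesis using F(2)[of "h x" j] by (metis f_def restrict_apply')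
  qed
  have common: "\<exists>j. x \<in> layer r j \<and> y \<in> layer r j" for x y
  proof -
    obtain i j where "x \<in> layer r i" "y \<in> layer r j" using exh(1) by blast
    then show ?thesis
      using layer_mono[of i "max i j" r] layer_mono[of j "max i j" r] by auto
  qed
  have bij: "bij_betw (F j) (layer r j) (layer q j)" for j using F(1)[of j] by (simp add: I_def)
  have "inj f"
  proof (rule injI)
    fix x y assume "f x = f y"
    with common[of x y] f bij show "x = y" by (metis bij_betw_inv_into_left)
  qed
  moreover have "y \<in> range f" for y
  proof -
    obtain j where "y \<in> layer q j" using exh(2) by blast
    then obtain x where "x \<in> layer r j" "y = F j x" using bij[of j] by (auto simp: bij_betw_def)
    then show ?thesis using f[of x j] by (metis rangeI)
  qed
  moreover have "(x, y) \<in> r \<longleftrightarrow> (f x, f y) \<in> q" for x y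
    using common[of x y] f F(1) unfolding I_def by fastforce
  ultimately show ?thesis
    by (auto simp: causet_iso_def bij_betw_def intro!: exI[of _ f])
qed

section \<open>Almost sure finiteness of the layers\<close>

lemma finite_finite_labeled: "finite (finite_labeled n)"
  by (rule finite_subset[of _ "Pow ({..<n} \<times> {..<n})"])
     (auto simp: finite_labeled_def causet_def)

lemma labeledD:
  assumes "c \<in> labeled"
  shows "(x, y) \<in> c \<Longrightarrow> x < y" "trans c"
  using assms by (auto simp: labeled_def natural_labeling_def causet_def)

lemma finite_labeledI:
  assumes "trans b" "\<And>x y. (x, y) \<in> b \<Longrightarrow> x < y" "\<And>x y. (x, y) \<in> b \<Longrightarrow> y < n"
  shows "b \<in> finite_labeled n"
proof -
  have "irrefl b" using assms(2) by (auto simp: irrefl_def)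
  moreover have "b \<subseteq> {..<n} \<times> {..<n}" by (auto intro: less_trans[OF assms(2,3)] assms(3))
  ultimately show ?thesis
    using assms by (auto simp: finite_labeled_def causet_def natural_labeling_def)
qed

lemma Restr_finite_labeled:
  assumes "trans c" "\<And>x y. (x, y) \<in> c \<Longrightarrow> x < y"
  shows "Restr c {..<n} \<in> finite_labeled n"
  by (rule finite_labeledI) (use assms in \<open>auto intro!: transI dest: transD\<close>)

lemma Restr_labeled: "c \<in> labeled \<Longrightarrow> Restr c {..<n} \<in> finite_labeled n"
  using labeledD by (intro Restr_finite_labeled) auto

text \<open>Only finitely many restrictions to \<open>{..<n}\<close> are possible, so the event is a
  finite union of cylinders.\<close>

lemma Restr_event: "{c \<in> labeled. P (Restr c {..<n})} \<in> labeled_events"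
proof -
  interpret sigma_algebra labeled labeled_events by (rule sigma_algebra_labeled_events)
  have "{c \<in> labeled. P (Restr c {..<n})} = (\<Union>b\<in>{b \<in> finite_labeled n. P b}. cyl n b)"
    using Restr_labeled by (auto simp: cyl_def)
  also have "\<dots> \<in> labeled_events"
    using finite_finite_labeled by (intro finite_UN) (auto simp: labeled_events_def)
  finally show ?thesis .
qed

lemma relation_event: "{c \<in> labeled. (x, y) \<in> c} \<in> labeled_events"
proof -
  have "{c \<in> labeled. (x, y) \<in> c} = {c \<in> labeled. (x, y) \<in> Restr c {..<Suc (max x y)}}"
    by auto
  then show ?thesis using Restr_event[of "\<lambda>b. (x, y) \<in> b"] by simp
qed

lemma measurable_relation [measurable]:
  "Measurable.pred (csg_labeled_measure t) (\<lambda>c. (x, y) \<in> c)"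
  unfolding pred_def sets_csg_labeled_measure using relation_event by simp

lemma measurable_layer [measurable]:
  "Measurable.pred (csg_labeled_measure t) (\<lambda>c. x \<in> layer c j)"
  by (induction j arbitrary: x) auto

lemma finite_layers_event:
  "{c \<in> labeled. \<forall>j. finite (layer c j)} \<in> labeled_events"
proof -
  \<comment> \<open>The sets of \<open>csg_labeled_measure t\<close> are
    \<open>labeled_events\<close> for every \<open>t\<close>; an arbitrary \<open>t\<close> serves
    to make the measurability rules applicable.\<close>
  have "Measurable.pred (csg_labeled_measure t) (\<lambda>c. \<forall>j. finite (layer c j))" for t
    unfolding finite_nat_set_iff_bounded Ball_def by measurable
  then show ?thesis unfolding pred_def sets_csg_labeled_measure .
qed

section \<open>Probability estimates for the past of a newborn element\<close>

lemma cyl_prob_Suc: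
  "cyl_prob t (Suc n) b =
    cyl_prob t n (Restr b {..<n}) * transition_prob t n (Restr b {..<n}) {x. (x, n) \<in> b}"
  if "b \<in> finite_labeled (Suc n)"
proof -
  have eq: "transition_prob t i (Restr b {..<i}) {x. (x, i) \<in> b} =
      transition_prob t i (Restr (Restr b {..<n}) {..<i}) {x. (x, i) \<in> Restr b {..<n}}"
    if "i < n" for i
  proof -
    have "{x. (x, i) \<in> b} = {x. (x, i) \<in> Restr b {..<n}}"
      and "Restr b {..<i} = Restr (Restr b {..<n}) {..<i}"
      using that finite_labeledD(1)[OF \<open>b \<in> _\<close>, of _ i] by fastforce+
    then show ?thesis by simp
  qed
  have "(\<Prod>i<n. transition_prob t i (Restr b {..<i}) {x. (x, i) \<in> b}) =
      cyl_prob t n (Restr b {..<n})"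
    unfolding cyl_prob_def by (rule prod.cong[OF refl], rule eq) simp
  then show ?thesis unfolding cyl_prob_def by simp
qed

text \<open>By \<open>sum_card_between\<close> the left side sums \<open>t (card K)\<close> over the
  sets \<open>K\<close> between \<open>m\<close> and \<open>s\<close>, all of which are subsets of
  \<open>F\<close>. The bound depends on \<open>F\<close> only.\<close>

lemma csg_lambda_le:
  assumes t: "csg_couplings t" and F: "finite F" "s \<subseteq> F" "m \<subseteq> s"
  shows "csg_lambda t (card s) (card m) \<le> (\<Sum>K\<in>Pow F. t (card K))"
  unfolding sum_card_between[OF finite_subset[OF F(2,1)] F(3), symmetric]
  by (rule sum_mono2) (use t F in \<open>auto simp: csg_couplings_def\<close>)

lemma cyl_prob_nonneg: "csg_couplings t \<Longrightarrow> 0 \<le> cyl_prob t n b"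
  unfolding cyl_prob_def transition_prob_def
  by (intro prod_nonneg divide_nonneg_nonneg ballI csg_lambda_nonneg)

text \<open>The cylinders over \<open>finite_labeled n\<close> partition the probability
  space.\<close>

lemma sum_cyl_prob:
  assumes t: "csg_couplings t"
  shows "(\<Sum>b\<in>finite_labeled n. cyl_prob t n b) = 1"
proof -
  let ?M = "csg_labeled_measure t"
  interpret prob_space ?M by (rule csg_labeled_measure(1)[OF t])
  note nn = cyl_prob_nonneg[OF t]
  have "labeled = (\<Union>b\<in>finite_labeled n. cyl n b)"
    using Restr_labeled by (auto simp: cyl_def)
  then have "1 = measure ?M (\<Union>b\<in>finite_labeled n. cyl n b)"
    using prob_space sets_csg_labeled_measure by simp
  also have "\<dots> = (\<Sum>b\<in>finite_labeled n. measure ?M (cyl n b))"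
    using finite_finite_labeled
    by (intro finite_measure_finite_Union)
       (auto simp: sets_csg_labeled_measure labeled_events_def disjoint_family_on_def cyl_def)
  also have "\<dots> = (\<Sum>b\<in>finite_labeled n. cyl_prob t n b)"
    using nn by (intro sum.cong) (simp_all add: measure_def csg_labeled_measure(2)[OF t])
  finally show ?thesis by simp
qed

text \<open>Whatever causet has formed on \<open>{..<n}\<close>, the newborn \<open>n\<close>
  receives the past \<open>s\<close> with probability at most the right side, by
  \<open>csg_lambda_le\<close>. Averaging over the causets on \<open>{..<n}\<close> preserves this
  bound.\<close>

lemma prob_past_eq_le:
  assumes t: "csg_couplings t" and F: "finite F" "s \<subseteq> F"
  shows "measure (csg_labeled_measure t) {c \<in> labeled. {x. (x, n) \<in> c} = s}
    \<le> (\<Sum>K\<in>Pow F. t (card K)) / csg_lambda t n 0"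
proof -
  let ?M = "csg_labeled_measure t" and ?C = "\<Sum>K\<in>Pow F. t (card K)"
  let ?B = "{b \<in> finite_labeled (Suc n). {x. (x, n) \<in> b} = s}"
  interpret prob_space ?M by (rule csg_labeled_measure(1)[OF t])
  note nn = cyl_prob_nonneg[OF t]
  have C: "0 \<le> ?C" using t by (intro sum_nonneg) (auto simp: csg_couplings_def)
  have eq: "{x. (x, n) \<in> c} = {x. (x, n) \<in> Restr c {..<Suc n}}" if "c \<in> labeled" for c
    using labeledD(1)[OF that, of _ n] by (auto intro: less_SucI)
  have "{c \<in> labeled. {x. (x, n) \<in> c} = s} = (\<Union>b\<in>?B. cyl (Suc n) b)"
    using Restr_labeled eq by (auto simp: cyl_def)
  then have "measure ?M {c \<in> labeled. {x. (x, n) \<in> c} = s} = (\<Sum>b\<in>?B. measure ?M (cyl (Suc n) b))"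
    using finite_finite_labeled
    by (simp, intro finite_measure_finite_Union)
       (auto simp: sets_csg_labeled_measure labeled_events_def disjoint_family_on_def cyl_def)
  also have "\<dots> = (\<Sum>b\<in>?B. cyl_prob t (Suc n) b)"
    using nn by (intro sum.cong) (simp_all add: measure_def csg_labeled_measure(2)[OF t])
  also have "\<dots> \<le> (\<Sum>b\<in>?B. cyl_prob t n (Restr b {..<n}) * (?C / csg_lambda t n 0))"
  proof (rule sum_mono)
    fix b assume b: "b \<in> ?B"
    have "transition_prob t n (Restr b {..<n}) s \<le> ?C / csg_lambda t n 0"
      unfolding transition_prob_def
      by (rule divide_right_mono[OF csg_lambda_le[OF t F]])
         (auto simp: maximal_elements_def csg_lambda_nonneg[OF t])
    then show "cyl_prob t (Suc n) b \<le> cyl_prob t n (Restr b {..<n}) * (?C / csg_lambda t n 0)"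
      using b nn by (simp add: cyl_prob_Suc mult_left_mono del: times_divide_eq_right)
  qed
  also have "\<dots> = (\<Sum>b\<in>?B. cyl_prob t n (Restr b {..<n})) * (?C / csg_lambda t n 0)"
    by (rule sum_distrib_right[symmetric])
  also have "\<dots> \<le> 1 * (?C / csg_lambda t n 0)"
  proof (rule mult_right_mono)
    \<comment> \<open>With the past of \<open>n\<close> fixed as \<open>s\<close>, a causet in
      \<open>?B\<close> is determined by its restriction to \<open>{..<n}\<close>. Hence the sum
      over \<open>?B\<close> is part of the total probability 1 at stage \<open>n\<close>.\<close>
    have inj: "inj_on (\<lambda>b. Restr b {..<n}) ?B"
    proof (rule inj_onI)
      fix b d assume b: "b \<in> ?B" and d: "d \<in> ?B" and eq: "Restr b {..<n} = Restr d {..<n}"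
      have b': "b \<in> finite_labeled (Suc n)" and d': "d \<in> finite_labeled (Suc n)"
        using b d by simp_all
      have "(x, y) \<in> b \<longleftrightarrow> (x, y) \<in> d" for x y
      proof -
        note D = finite_labeledD(1,2)[OF b', of x y] finite_labeledD(1,2)[OF d', of x y]
        consider "y < n" | "y = n" | "y > n" by linarith
        then show ?thesis
        proof cases
          case 1
          then have "x < n" if "(x, y) \<in> b \<or> (x, y) \<in> d"
            using that D(1,3) by (meson less_trans)
          with 1 have "(x, y) \<in> b \<longleftrightarrow> (x, y) \<in> Restr b {..<n}"
            and "(x, y) \<in> d \<longleftrightarrow> (x, y) \<in> Restr d {..<n}"
            by blast+
          then show ?thesis by (simp only: eq)
        next
          case 2 then show ?thesis using b d by blast
        next
          case 3 then show ?thesis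
            using D by auto
        qed
      qed
      then show "b = d" by auto
    qed
    have "(\<Sum>b\<in>?B. cyl_prob t n (Restr b {..<n})) =
        (\<Sum>b\<in>(\<lambda>b. Restr b {..<n}) ` ?B. cyl_prob t n b)"
      by (rule sum.reindex_cong[OF inj, symmetric]) auto
    also have "\<dots> \<le> (\<Sum>b\<in>finite_labeled n. cyl_prob t n b)"
      by (rule sum_mono2[OF finite_finite_labeled])
         (use nn finite_labeledD in \<open>auto intro!: Restr_finite_labeled\<close>)
    finally show "(\<Sum>b\<in>?B. cyl_prob t n (Restr b {..<n})) \<le> 1" using sum_cyl_prob[OF t] by simp
  qed (use C csg_lambda_nonneg[OF t] in auto)
  finally show ?thesis by simp
qed

text \<open>This is where \<open>t k > 0\<close> for some \<open>k \<ge> 2\<close> enters.\<close>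

lemma summable_inverse_csg_lambda:
  assumes t: "csg_couplings t"
  shows "summable (\<lambda>n. 1 / csg_lambda t n 0)"
proof -
  obtain k where k: "k \<ge> 2" "0 < t k" using t by (auto simp: csg_couplings_def)
  \<comment> \<open>The single summand with index \<open>k\<close> already gives
    \<open>csg_lambda t n 0\<close> at least \<open>(n choose k) * t k\<close>, hence at least
    \<open>(n / k) ^ k * t k\<close>, and \<open>n ^ k\<close> is at least
    \<open>n ^ 2\<close>.\<close>
  have "1 / csg_lambda t n 0 \<le> (real k ^ k / t k) * inverse (real n ^ 2)" if n: "n \<ge> k" for n
  proof -
    have n0: "0 < real n" "0 < real k" using n k by auto
    have "real n ^ 2 / real k ^ k \<le> real n ^ k / real k ^ k"
      using n k by (intro divide_right_mono power_increasing) auto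
    also have "\<dots> = (real n / real k) ^ k" by (simp add: power_divide)
    also have "\<dots> \<le> real (n choose k)" using binomial_ge_n_over_k_pow_k[OF n, where 'a = real] by simp
    finally have "real n ^ 2 / real k ^ k * t k \<le> real (n choose k) * t k"
      using k by (intro mult_right_mono) auto
    also have "\<dots> \<le> (\<Sum>i\<in>{0..n}. real (n choose i) * t i)"
      by (rule member_le_sum) (use t n in \<open>auto simp: csg_couplings_def\<close>)
    also have "\<dots> = csg_lambda t n 0" by (simp add: csg_lambda_def)
    finally have "1 / csg_lambda t n 0 \<le> 1 / (real n ^ 2 / real k ^ k * t k)"
      using n0 k by (intro divide_left_mono mult_pos_pos csg_lambda_0_pos[OF t]) auto
    then show ?thesis using n0 k by (simp add: field_simps)
  qed
  then have "\<forall>n\<ge>k. norm (1 / csg_lambda t n 0) \<le> (real k ^ k / t k) * inverse (real n ^ 2)"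
    using csg_lambda_0_pos[OF t] by (simp add: less_imp_le)
  moreover have "summable (\<lambda>n. (real k ^ k / t k) * inverse (real n ^ 2))"
    by (intro summable_mult inverse_power_summable) auto
  ultimately show ?thesis by (rule summable_comparison_test[OF exI])
qed

text \<open>For each fixed \<open>s \<subseteq> F\<close> the probabilities that the past of
  \<open>n\<close> equals \<open>s\<close> are summable over \<open>n\<close>, so Borel-Cantelli
  applies; there are only finitely many such \<open>s\<close>.\<close>

lemma AE_finite_future:
  assumes t: "csg_couplings t" and F: "finite F"
  shows "AE c in csg_labeled_measure t. finite {n. {x. (x, n) \<in> c} \<subseteq> F}"
proof -
  let ?M = "csg_labeled_measure t"
  interpret prob_space ?M by (rule csg_labeled_measure(1)[OF t])
  have sets: "{c \<in> labeled. {x. (x, n) \<in> c} = s} \<in> sets ?M" for n s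
  proof -
    have "Measurable.pred ?M (\<lambda>c. \<forall>x. (x, n) \<in> c \<longleftrightarrow> x \<in> s)" by measurable
    then show ?thesis
      by (simp add: pred_def sets_csg_labeled_measure(1) set_eq_iff)
  qed
  have "AE c in ?M. eventually (\<lambda>n. c \<in> space ?M - {c \<in> labeled. {x. (x, n) \<in> c} = s}) sequentially"
    if s: "s \<subseteq> F" for s
  proof (rule borel_cantelli_AE1)
    show "summable (\<lambda>n. measure ?M {c \<in> labeled. {x. (x, n) \<in> c} = s})"
    proof (rule summable_comparison_test)
      show "summable (\<lambda>n. (\<Sum>K\<in>Pow F. t (card K)) * (1 / csg_lambda t n 0))"
        by (intro summable_mult summable_inverse_csg_lambda t)
    qed (use prob_past_eq_le[OF t F s] in auto)
  qed (auto simp: sets less_top[symmetric])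
  then have "AE c in ?M. \<forall>s\<in>Pow F. eventually (\<lambda>n. c \<in> space ?M - {c \<in> labeled. {x. (x, n) \<in> c} = s}) sequentially"
    using F by (intro AE_finite_allI) auto
  then show ?thesis
  proof eventually_elim
    case (elim c)
    then have "eventually (\<lambda>n. \<forall>s\<in>Pow F. c \<in> space ?M - {c \<in> labeled. {x. (x, n) \<in> c} = s}) sequentially"
      using F by (intro eventually_ball_finite) auto
    then have "eventually (\<lambda>n. \<not> {x. (x, n) \<in> c} \<subseteq> F) sequentially"
      by eventually_elim (auto simp: sets_csg_labeled_measure)
    then show ?case by (simp add: eventually_cofinite flip: cofinite_eq_sequentially)
  qed
qed

text \<open>Layer \<open>j + 1\<close> consists of the \<open>n\<close> whose past lies in layer
  \<open>j\<close>, so induction on \<open>j\<close> works once \<open>AE_finite_future\<close>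
  holds for all finite \<open>F\<close> at once. The simultaneous statement is required because the
  layer is random; it is available because there are countably many finite \<open>F\<close>.\<close>

lemma AE_finite_layers:
  assumes t: "csg_couplings t"
  shows "AE c in csg_labeled_measure t. \<forall>j. finite (layer c j)"
proof -
  have "AE c in csg_labeled_measure t. \<forall>F\<in>{F. finite F}. finite {n. {x. (x, n) \<in> c} \<subseteq> F}"
    using AE_finite_future[OF t] by (subst AE_ball_countable) (auto simp: countable_Collect_finite)
  then show ?thesis
  proof eventually_elim
    case (elim c)
    have "finite (layer c j)" for j
    proof (induction j)
      case (Suc j)
      then have "finite {n. {x. (x, n) \<in> c} \<subseteq> layer c j}" using elim by blast
      then show ?case by (rule rev_finite_subset) auto
    qed simp
    then show ?case by blast
  qed
qed

lemma labeled_layers_UNIV: "c \<in> labeled \<Longrightarrow> (\<Union>j. layer c j) = UNIV"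
  using layer_exhausts[of c] labeledD(1)[of c] by blast

section \<open>Stem events\<close>

text \<open>The condition behind \<open>stem_set\<close>, for a single labeled causet and a
  representative of the finite type. The relation \<open>c\<close> need not be restricted to
  \<open>s\<close>, since \<open>causet_iso\<close> looks only at pairs in \<open>s\<close>.\<close>

definition has_stem :: "'a rel \<Rightarrow> 'b set \<Rightarrow> 'b rel \<Rightarrow> bool" where
  "has_stem c V q \<longleftrightarrow> (\<exists>s. is_stem UNIV c s \<and> causet_iso V q s c)"

lemma has_stem_iso:
  assumes "causet_iso UNIV c UNIV d" "has_stem c V q"
  shows "has_stem d V q"
proof -
  obtain f where f: "bij f" "\<And>x y. (x, y) \<in> c \<longleftrightarrow> (f x, f y) \<in> d"
    using assms(1) by (auto simp: causet_iso_def)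
  obtain s where s: "is_stem UNIV c s" "causet_iso V q s c"
    using assms(2) by (auto simp: has_stem_def)
  have "is_stem UNIV d (f ` s)"
    unfolding is_stem_def
  proof (intro conjI allI impI)
    fix x y assume *: "(x, y) \<in> d \<and> y \<in> f ` s"
    obtain x' where "x = f x'" using f(1) by (metis bij_pointE)
    with * f s(1) show "x \<in> f ` s" by (auto simp: is_stem_def)
  qed (use s in \<open>auto simp: is_stem_def\<close>)
  moreover have "causet_iso s c (f ` s) d"
    using f by (auto simp: causet_iso_def intro!: exI[of _ f] bij_betw_subset[of f UNIV UNIV])
  ultimately show ?thesis using causet_iso_trans[OF s(2)] by (auto simp: has_stem_def)
qed

lemma is_stem_causet:
  assumes "c \<in> labeled" "is_stem UNIV c s"
  shows "(s, Restr c s) \<in> finite_causets"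
proof -
  have "irrefl c" using assms(1) by (auto simp: labeled_def causet_def)
  moreover have "trans (Restr c s)" using labeledD(2)[OF assms(1)] by (auto intro!: transI dest: transD)
  ultimately show ?thesis using assms(2)
    by (auto simp: finite_causets_def causet_def is_stem_def irrefl_def intro: countable_finite)
qed

text \<open>The stem events pulled back to labeled causets, so that measurability can be shown for
  predicates of a representative instead of a class.\<close>

definition stem_algebra :: "nat rel measure" where
  "stem_algebra = vimage_algebra labeled iso_class (sigma unlabeled stem_events)"

lemma stem_events_sigma: "sets (sigma unlabeled stem_events) = stem_events"
proof -
  have "stem_events \<subseteq> Pow unlabeled"
    using sigma_sets_into_sp[of "stem_set ` finite_unlabeled" unlabeled]
    by (auto simp: stem_events_def stem_set_def)
  then have "sets (sigma unlabeled stem_events) = sigma_sets unlabeled stem_events" by simp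
  also have "\<dots> = stem_events" unfolding stem_events_def by (rule sigma_sets_sigma_sets_eq) (auto simp: stem_set_def)
  finally show ?thesis .
qed

lemma space_stem_algebra [simp]: "space stem_algebra = labeled"
  by (simp add: stem_algebra_def)

lemma sets_stem_algebra: "sets stem_algebra = {iso_class -` B \<inter> labeled | B. B \<in> stem_events}"
  unfolding stem_algebra_def
  by (subst sets_vimage_algebra2)
     (auto simp: stem_events_sigma iso_class_in_unlabeled space_measure_of_conv)

text \<open>\<open>stem_set\<close> asks for the stem in some representative of the class;
  \<open>has_stem_iso\<close> moves it to \<open>c\<close>.\<close>

lemma iso_class_stem_set:
  assumes c: "c \<in> labeled" and V: "(V, q) \<in> finite_causets"
  shows "iso_class c \<in> stem_set (finite_iso `` {(V, q)}) \<longleftrightarrow> has_stem c V q"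
proof
  assume "iso_class c \<in> stem_set (finite_iso `` {(V, q)})"
  then obtain d s where "(c, d) \<in> labeled_iso" and s: "is_stem UNIV d s" "causet_iso V q s (Restr d s)"
    by (auto simp: stem_set_def iso_class_def finite_iso_def)
  then have "causet_iso UNIV d UNIV c" by (auto simp: labeled_iso_def intro: causet_iso_sym)
  moreover have "has_stem d V q" using s by (auto simp: has_stem_def causet_iso_Restr')
  ultimately show "has_stem c V q" by (rule has_stem_iso)
next
  assume "has_stem c V q"
  then obtain s where s: "is_stem UNIV c s" "causet_iso V q s c" by (auto simp: has_stem_def)
  then have "(s, Restr c s) \<in> finite_iso `` {(V, q)}"
    using V is_stem_causet[OF c s(1)] by (simp add: finite_iso_def causet_iso_Restr')
  moreover have "c \<in> iso_class c"
    using c by (simp add: iso_class_def labeled_iso_def causet_iso_refl)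
  ultimately show "iso_class c \<in> stem_set (finite_iso `` {(V, q)})"
    using s(1) c by (auto simp: stem_set_def iso_class_in_unlabeled)
qed

lemma pred_has_stem:
  assumes V: "(V, q) \<in> finite_causets"
  shows "Measurable.pred stem_algebra (\<lambda>c. has_stem c V q)"
proof -
  have "{c \<in> labeled. has_stem c V q} = iso_class -` stem_set (finite_iso `` {(V, q)}) \<inter> labeled"
    using iso_class_stem_set[OF _ V] by auto
  moreover have "stem_set (finite_iso `` {(V, q)}) \<in> stem_events"
    unfolding stem_events_def
    by (intro sigma_sets.Basic imageI) (use V in \<open>auto simp: finite_unlabeled_def intro: quotientI\<close>)
  ultimately show ?thesis unfolding pred_def space_stem_algebra sets_stem_algebra by blast
qed

text \<open>A finite layer contains every stem of height at most \<open>j\<close> and is itself such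
  a stem. So \<open>V\<close> is its type exactly if \<open>V\<close> is a stem of that height of
  greatest cardinality. The right side combines countably many stem conditions; it fails if the
  layer is infinite, because then every such stem can be enlarged.\<close>

lemma causet_iso_layer_iff:
  assumes c: "c \<in> labeled" and V: "(V, q) \<in> finite_causets"
  shows "causet_iso V q (layer c j) c \<longleftrightarrow> V \<subseteq> layer q j \<and> has_stem c V q \<and>
    (\<forall>(W, p)\<in>finite_causets. W \<subseteq> layer p j \<and> card V < card W \<longrightarrow> \<not> has_stem c W p)"
    (is "?L \<longleftrightarrow> ?R")
proof -
  \<comment> \<open>The height of a stem can be read off any isomorphic copy, because stems contain
    the pasts of their elements.\<close>
  have height: "W \<subseteq> layer p j \<longleftrightarrow> s \<subseteq> layer c j"
    if "(W, p) \<in> finite_causets" "is_stem UNIV c s" "causet_iso W p s c" for W p s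
  proof -
    obtain f where f: "bij_betw f W s"
      "\<And>x y. x \<in> W \<Longrightarrow> y \<in> W \<Longrightarrow> (x, y) \<in> p \<longleftrightarrow> (f x, f y) \<in> c"
      using \<open>causet_iso W p s c\<close> unfolding causet_iso_def by blast
    have "f x \<in> layer c j \<longleftrightarrow> x \<in> layer p j" if "x \<in> W" for x
      by (rule layer_iso[OF f(1)])
         (use that f(2) \<open>(W, p) \<in> _\<close> \<open>is_stem _ _ _\<close> in
           \<open>auto simp: finite_causets_def causet_def is_stem_def\<close>)
    then show ?thesis using f(1) by (fastforce simp: bij_betw_def)
  qed
  show ?thesis
  proof
    assume iso: ?L
    have fin: "finite (layer c j)"
      using causet_iso_finite[OF iso] V by (simp add: finite_causets_def)
    then have "is_stem UNIV c (layer c j)" by (auto simp: is_stem_def intro: layer_down_closed)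
    with iso V have "V \<subseteq> layer q j \<and> has_stem c V q" using height by (auto simp: has_stem_def)
    moreover have "\<not> has_stem c W p"
      if W: "(W, p) \<in> finite_causets" "W \<subseteq> layer p j" "card V < card W" for W p
    proof
      assume "has_stem c W p"
      then obtain s where s: "is_stem UNIV c s" "causet_iso W p s c" by (auto simp: has_stem_def)
      then have "card s \<le> card (layer c j)"
        using height[OF W(1)] W(2) by (intro card_mono fin) blast
      then show False using W(3) causet_iso_card[OF s(2)] causet_iso_card[OF iso] by simp
    qed
    ultimately show ?R by blast
  next
    assume R: ?R
    then obtain s where s: "is_stem UNIV c s" "causet_iso V q s c" by (auto simp: has_stem_def)
    have sub: "s \<subseteq> layer c j" using R height[OF V s] by blast
    have "layer c j \<subseteq> s"
    proof
      fix x assume x: "x \<in> layer c j"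
      show "x \<in> s"
      proof (rule ccontr)
        assume "x \<notin> s"
        \<comment> \<open>Adding \<open>x\<close> together with its whole past gives a strictly
          larger stem that still lies in the layer, against the maximality of
          \<open>card V\<close>.\<close>
        let ?s = "s \<union> {y. y = x \<or> (y, x) \<in> c}"
        have fin: "finite ?s"
          using s(1) labeledD(1)[OF c, of _ x]
          by (auto simp: is_stem_def intro: finite_subset[of _ "{..x}"] less_imp_le)
        then have stem: "is_stem UNIV c ?s"
          using s(1) labeledD(2)[OF c] by (auto simp: is_stem_def dest: transD)
        have "?s \<subseteq> layer c j" using sub x layer_down_closed[of _ x c j] by auto
        then have "?s \<subseteq> layer (Restr c ?s) j"
          using height[OF is_stem_causet[OF c stem] stem] by (simp add: causet_iso_Restr causet_iso_refl)
        moreover have "has_stem c ?s (Restr c ?s)"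
          unfolding has_stem_def using stem causet_iso_Restr causet_iso_refl by blast
        ultimately have "card ?s \<le> card V" using R is_stem_causet[OF c stem] by fastforce
        also have "card V = card s" by (rule causet_iso_card[OF s(2)])
        also have "card s < card ?s" by (rule psubset_card_mono[OF fin]) (use \<open>x \<notin> s\<close> in auto)
        finally show False by simp
      qed
    qed
    with sub s(2) show ?L by (metis subset_antisym)
  qed
qed

section \<open>Isomorphism types of layers as stem events\<close>

lemma countable_finite_causets: "countable finite_causets"
proof (rule countable_subset)
  show "finite_causets \<subseteq> Collect finite \<times> Collect finite"
    by (auto simp: finite_causets_def causet_def intro: finite_subset)
qed (intro countable_SIGMA countable_Collect_finite)

lemma pred_Ball_countable:
  assumes "countable X" "\<And>i. i \<in> X \<Longrightarrow> Measurable.pred M (\<lambda>x. P x i)"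
  shows "Measurable.pred M (\<lambda>x. \<forall>i\<in>X. P x i)"
  using assms unfolding pred_def by (intro sets.sets_Collect_countable_All')

lemma pred_Bex_countable:
  assumes "countable X" "\<And>i. i \<in> X \<Longrightarrow> Measurable.pred M (\<lambda>x. P x i)"
  shows "Measurable.pred M (\<lambda>x. \<exists>i\<in>X. P x i)"
  using assms unfolding pred_def by (intro sets.sets_Collect_countable_Ex')

lemma pred_causet_iso_layer:
  assumes V: "(V, q) \<in> finite_causets"
  shows "Measurable.pred stem_algebra (\<lambda>c. causet_iso V q (layer c j) c)"
proof -
  have "Measurable.pred stem_algebra (\<lambda>c. V \<subseteq> layer q j \<and> has_stem c V q \<and>
      (\<forall>Wp\<in>finite_causets. fst Wp \<subseteq> layer (snd Wp) j \<and> card V < card (fst Wp) \<longrightarrow>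
        \<not> has_stem c (fst Wp) (snd Wp)))"
    by (intro pred_intros_logic pred_Ball_countable countable_finite_causets pred_has_stem V
        measurable_const) auto
  then show ?thesis
    by (rule measurable_cong[THEN iffD1, rotated])
       (use causet_iso_layer_iff[OF _ V] in \<open>force simp: case_prod_beta\<close>)
qed

text \<open>A layer is finite exactly if it has the type of one of the countably many members of
  \<open>finite_causets\<close>.\<close>

lemma pred_finite_layers: "Measurable.pred stem_algebra (\<lambda>c. \<forall>j. finite (layer c j))"
proof -
  have "finite (layer c j) \<longleftrightarrow> (\<exists>Wp\<in>finite_causets. causet_iso (fst Wp) (snd Wp) (layer c j) c)"
    if c: "c \<in> labeled" for c j
  proof
    assume "finite (layer c j)"
    then have "is_stem UNIV c (layer c j)" by (auto simp: is_stem_def intro: layer_down_closed)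
    from is_stem_causet[OF c this] show "\<exists>Wp\<in>finite_causets. causet_iso (fst Wp) (snd Wp) (layer c j) c"
      by (rule bexI[rotated]) (simp add: causet_iso_Restr causet_iso_refl)
  qed (auto simp: finite_causets_def dest: causet_iso_finite)
  moreover have "Measurable.pred stem_algebra
      (\<lambda>c. \<forall>j. \<exists>Wp\<in>finite_causets. causet_iso (fst Wp) (snd Wp) (layer c j) c)"
    by (intro pred_intros_countable pred_Bex_countable countable_finite_causets
        pred_causet_iso_layer) simp
  ultimately show ?thesis by (subst measurable_cong) auto
qed


section \<open>A canonical labeling\<close>

text \<open>The elements of the new layer are numbered from \<open>n\<close> on in any order. This
  is a natural labeling: all predecessors of an element of layer \<open>j + 1\<close> lie in layer
  \<open>j\<close> and thus have labels below \<open>n\<close>, and among those labels the order is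
  \<open>b\<close>.\<close>

lemma extend_layer_labeling:
  assumes c: "c \<in> labeled" "finite (layer c (Suc j))" and b: "b \<in> finite_labeled n"
    and iso: "causet_iso {..<n} b (layer c j) c"
  obtains m d where "d \<in> finite_labeled m" "n \<le> m" "Restr d {..<n} = b"
    "causet_iso {..<m} d (layer c (Suc j)) c"
proof -
  obtain f where f: "bij_betw f {..<n} (layer c j)"
    "\<And>x y. x < n \<Longrightarrow> y < n \<Longrightarrow> (x, y) \<in> b \<longleftrightarrow> (f x, f y) \<in> c"
    using iso unfolding causet_iso_def by auto
  let ?D = "layer c (Suc j) - layer c j"
  define m where "m = n + card ?D"
  obtain h where h: "bij_betw h {0..<card ?D} ?D"
    using ex_bij_betw_nat_finite[of ?D] c(2) by blast
  define g where "g x = (if x < n then f x else h (x - n))" for x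
  have "bij_betw g {..<n} (layer c j)"
    using f(1) by (rule bij_betw_cong[THEN iffD1, rotated]) (simp add: g_def)
  moreover have "bij_betw g {n..<m} ?D"
  proof -
    have "bij_betw (\<lambda>x. x - n) {n..<m} {0..<card ?D}"
      by (rule bij_betwI[of _ _ _ "\<lambda>x. x + n"]) (auto simp: m_def)
    from bij_betw_trans[OF this h] show ?thesis
      by (rule bij_betw_cong[THEN iffD1, rotated]) (simp add: g_def)
  qed
  ultimately have "bij_betw g ({..<n} \<union> {n..<m}) (layer c j \<union> ?D)"
    by (rule bij_betw_combine) auto
  moreover have "{..<n} \<union> {n..<m} = {..<m}" by (auto simp: m_def)
  moreover have "layer c j \<union> ?D = layer c (Suc j)" using layer_mono_Suc[of c j] by blast
  ultimately have g: "bij_betw g {..<m} (layer c (Suc j))" by (simp only:)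
  have gf: "g x \<in> layer c j \<longleftrightarrow> x < n" if "x < m" for x
  proof
    assume "g x \<in> layer c j"
    then obtain y where "y < n" "g x = g y"
      using \<open>bij_betw g {..<n} (layer c j)\<close> by (auto simp: bij_betw_def image_iff)
    then show "x < n"
      using inj_onD[OF bij_betw_imp_inj_on[OF g], of x y] that by (simp add: m_def)
  qed (use f(1) in \<open>auto simp: g_def bij_betw_def\<close>)
  define d where "d = {(x, y). x < m \<and> y < m \<and> (g x, g y) \<in> c}"
  have less: "x < y" if "(x, y) \<in> d" for x y
  proof -
    have *: "x < m" "y < m" "(g x, g y) \<in> c" using that by (auto simp: d_def)
    have "g y \<in> layer c (Suc j)" using g *(2) by (auto simp: bij_betw_def)
    then have "g x \<in> layer c j" using *(3) by simp
    then have "x < n" using *(1) gf by blast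
    show ?thesis
    proof (cases "y < n")
      case True
      then have "(f x, f y) \<in> c" using *(3) \<open>x < n\<close> by (simp add: g_def)
      then have "(x, y) \<in> b" using f(2) True \<open>x < n\<close> by blast
      then show ?thesis by (rule finite_labeledD(1)[OF b])
    qed (use \<open>x < n\<close> in simp)
  qed
  have "trans d" using labeledD(2)[OF c(1)] by (auto simp: d_def intro!: transI dest: transD)
  then have "d \<in> finite_labeled m" by (rule finite_labeledI) (erule less, simp add: d_def)
  moreover have "n \<le> m" by (simp add: m_def)
  moreover have "Restr d {..<n} = b"
  proof -
    have "(x, y) \<in> Restr d {..<n} \<longleftrightarrow> (x, y) \<in> b" for x y
    proof (cases "x < n \<and> y < n")
      case True
      then show ?thesis using f(2) by (auto simp: d_def g_def m_def)
    next
      case False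
      then show ?thesis using finite_labeledD(1,2)[OF b, of x y] by auto
    qed
    then show ?thesis by auto
  qed
  moreover have "causet_iso {..<m} d (layer c (Suc j)) c"
    using g by (auto simp: causet_iso_def d_def intro!: exI[of _ g])
  ultimately show thesis by (rule that)
qed

text \<open>With codes in the natural numbers the choice of a finite labeled causet becomes a
  \<open>LEAST\<close>, which preserves measurability.\<close>

definition labeled_code :: "nat \<Rightarrow> nat \<times> nat rel" where
  "labeled_code = from_nat_into {(n, b). b \<in> finite_labeled n}"

abbreviation code_size :: "nat \<Rightarrow> nat" where "code_size i \<equiv> fst (labeled_code i)"
abbreviation code_rel :: "nat \<Rightarrow> nat rel" where "code_rel i \<equiv> snd (labeled_code i)"

lemma code_rel: "code_rel i \<in> finite_labeled (code_size i)"
proof -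
  \<comment> \<open>\<open>from_nat_into\<close> takes its values in the set only if the set is
    nonempty.\<close>
  have "(0, {}) \<in> {(n, b). b \<in> finite_labeled n}" using cyl_0(2) by simp
  then have "labeled_code i \<in> {(n, b). b \<in> finite_labeled n}"
    unfolding labeled_code_def by (metis from_nat_into empty_iff)
  then show ?thesis by (simp add: case_prod_beta)
qed

lemma labeled_code_surj:
  assumes "b \<in> finite_labeled n"
  obtains i where "code_size i = n" "code_rel i = b"
proof -
  have "{(n, b). b \<in> finite_labeled n} = (SIGMA n:UNIV. finite_labeled n)" by auto
  moreover have "countable (SIGMA n:UNIV. finite_labeled n)"
    by (rule countable_SIGMA) (simp_all add: countable_finite finite_finite_labeled)
  ultimately obtain i where "labeled_code i = (n, b)"
    unfolding labeled_code_def using assms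
    by (metis (mono_tags, lifting) case_prodI from_nat_into_surj mem_Collect_eq)
  then show thesis by (intro that[of i]) simp_all
qed

lemma code_finite_causets: "({..<code_size i}, code_rel i) \<in> finite_causets"
  using code_rel[of i] by (auto simp: finite_labeled_def finite_causets_def)

text \<open>The least code makes the choice of the next layer depend on the isomorphism types of the
  layers only.\<close>

primrec layer_code :: "nat rel \<Rightarrow> nat \<Rightarrow> nat" where
  "layer_code c 0 = (LEAST i. code_size i = 0)"
| "layer_code c (Suc j) = (LEAST i.
     code_size (layer_code c j) \<le> code_size i \<and>
     Restr (code_rel i) {..<code_size (layer_code c j)} = code_rel (layer_code c j) \<and>
     causet_iso {..<code_size i} (code_rel i) (layer c (Suc j)) c)"

definition canonical_labeling :: "nat rel \<Rightarrow> nat rel" where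
  "canonical_labeling c = (\<Union>j. code_rel (layer_code c j))"

text \<open>The previous code takes countably many values. With its value fixed, the next code is
  the least \<open>i\<close> that satisfies a predicate measurable for each
  \<open>i\<close>.\<close>

lemma measurable_layer_code: "(\<lambda>c. layer_code c j) \<in> measurable stem_algebra (count_space UNIV)"
proof (induction j)
  case (Suc j)
  show ?case unfolding layer_code.simps
    by (rule measurable_compose_countable[OF _ Suc])
       (intro measurable_Least pred_intros_logic measurable_const
         pred_causet_iso_layer code_finite_causets; simp)
qed simp

lemma pred_canonical_labeling: "Measurable.pred stem_algebra (\<lambda>c. (x, y) \<in> canonical_labeling c)"
proof -
  have "Measurable.pred stem_algebra (\<lambda>c. (x, y) \<in> code_rel (layer_code c j))" for j
    by (rule measurable_compose[OF measurable_layer_code]) simp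
  then show ?thesis by (simp add: canonical_labeling_def)
qed

text \<open>A \<open>LEAST\<close> has the desired property only if some number does.
  \<open>extend_layer_labeling\<close> supplies one at each stage, provided that the code before it
  describes layer \<open>j\<close>; hence the induction.\<close>

lemma layer_code:
  assumes c: "c \<in> labeled" "\<And>j. finite (layer c j)"
  shows "causet_iso {..<code_size (layer_code c j)} (code_rel (layer_code c j)) (layer c j) c"
    and "code_size (layer_code c j) \<le> code_size (layer_code c (Suc j))"
    and "Restr (code_rel (layer_code c (Suc j))) {..<code_size (layer_code c j)} =
      code_rel (layer_code c j)"
proof -
  let ?P = "\<lambda>j i. code_size (layer_code c j) \<le> code_size i \<and>
     Restr (code_rel i) {..<code_size (layer_code c j)} = code_rel (layer_code c j) \<and>
     causet_iso {..<code_size i} (code_rel i) (layer c (Suc j)) c"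
  have step: "?P j (layer_code c (Suc j))"
    if iso: "causet_iso {..<code_size (layer_code c j)} (code_rel (layer_code c j)) (layer c j) c"
    for j
  proof -
    obtain m d where "d \<in> finite_labeled m" and d: "code_size (layer_code c j) \<le> m"
      "Restr d {..<code_size (layer_code c j)} = code_rel (layer_code c j)"
      "causet_iso {..<m} d (layer c (Suc j)) c"
      using extend_layer_labeling[OF c code_rel iso] by metis
    then obtain i where "code_size i = m" "code_rel i = d" using labeled_code_surj by metis
    with d have "?P j i" by simp
    then show ?thesis unfolding layer_code.simps by (rule LeastI)
  qed
  have iso: "causet_iso {..<code_size (layer_code c j)} (code_rel (layer_code c j)) (layer c j) c" for j
  proof (induction j)
    case 0
    obtain i where "code_size i = 0" using labeled_code_surj[OF cyl_0(2)] by blast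
    then have "code_size (layer_code c 0) = 0" unfolding layer_code.simps by (rule LeastI)
    then show ?case by (simp add: causet_iso_def bij_betw_def)
  qed (use step in blast)
  from iso show "causet_iso {..<code_size (layer_code c j)} (code_rel (layer_code c j)) (layer c j) c" .
  from step[OF iso] show "code_size (layer_code c j) \<le> code_size (layer_code c (Suc j))"
    "Restr (code_rel (layer_code c (Suc j))) {..<code_size (layer_code c j)} =
      code_rel (layer_code c j)" by blast+
qed

text \<open>The codes describe finite causets \<open>b j\<close> on \<open>{..<N j}\<close>, each
  extending the previous one, and \<open>canonical_labeling c\<close> is their union. Its layers are
  exactly the initial segments \<open>{..<N j}\<close>, which are isomorphic to the layers of
  \<open>c\<close>, so \<open>causet_iso_of_layers\<close> applies.\<close>

lemma
  assumes c: "c \<in> labeled" "\<And>j. finite (layer c j)"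
  shows canonical_labeling_labeled: "canonical_labeling c \<in> labeled"
    and canonical_labeling_iso: "causet_iso UNIV c UNIV (canonical_labeling c)"
proof -
  define N where "N j = code_size (layer_code c j)" for j
  define b where "b j = code_rel (layer_code c j)" for j
  let ?s = "canonical_labeling c"
  have s: "?s = (\<Union>j. b j)" by (simp add: canonical_labeling_def b_def)
  have iso: "causet_iso {..<N j} (b j) (layer c j) c" for j
    using layer_code(1)[OF c] by (simp add: N_def b_def)
  have bfin: "b j \<in> finite_labeled (N j)" for j by (simp add: N_def b_def code_rel)
  have N: "N i \<le> N j" if "i \<le> j" for i j
    using lift_Suc_mono_le[of N, OF _ that] layer_code(2)[OF c] by (simp add: N_def)
  have b: "Restr (b j) {..<N i} = b i" if "i \<le> j" for i j
    using that
  proof (induction j rule: dec_induct)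
    case base
    show ?case using bfin[of i] by (auto simp: finite_labeled_def causet_def)
  next
    case (step j)
    have "Restr (b (Suc j)) {..<N i} = Restr (Restr (b (Suc j)) {..<N j}) {..<N i}"
      using N[OF step(1)] by auto
    also have "Restr (b (Suc j)) {..<N j} = b j" using layer_code(3)[OF c] by (simp add: N_def b_def)
    finally show ?case using step by simp
  qed
  have bmono: "b i \<subseteq> b j" if "i \<le> j" for i j using b[OF that] by blast
  have less: "x < y" if "(x, y) \<in> ?s" for x y using that finite_labeledD(1)[OF bfin] by (auto simp: s)
  show lab: "?s \<in> labeled"
  proof (rule labeledI[OF transI less])
    fix x y z assume "(x, y) \<in> ?s" "(y, z) \<in> ?s"
    then obtain i j where "(x, y) \<in> b i" "(y, z) \<in> b j" by (auto simp: s)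
    then have "(x, y) \<in> b (max i j)" "(y, z) \<in> b (max i j)"
      using bmono[of i "max i j"] bmono[of j "max i j"] by auto
    then show "(x, z) \<in> ?s" using finite_labeledD(3)[OF bfin] by (auto simp: s dest: transD)
  qed
  have Restr_s: "Restr ?s {..<N j} = b j" for j
  proof -
    have "Restr (b k) {..<N j} \<subseteq> b j" for k
      using b[of j k] bmono[of k j] le_cases[of j k] by blast
    moreover have "b j \<subseteq> Restr (b j) {..<N j}" using b[of j j] by simp
    ultimately show ?thesis unfolding s by blast
  qed
  have iso_s: "causet_iso {..<N j} ?s (layer c j) c" for j
    using iso[of j] unfolding Restr_s[of j, symmetric] causet_iso_Restr .
  \<comment> \<open>Counting identifies the layers: the case \<open>k = j\<close> puts
    \<open>{..<N j}\<close> inside layer \<open>j\<close>, and the cases of larger \<open>k\<close>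
    leave no room for further elements.\<close>
  have card: "card ({..<N k} \<inter> layer ?s j) = N j" if "j \<le> k" for j k
  proof -
    have "causet_iso ({..<N k} \<inter> layer ?s j) ?s (layer c k \<inter> layer c j) c"
      by (rule causet_iso_layer[OF iso_s]) (auto dest: less intro: layer_down_closed)
    then have "card ({..<N k} \<inter> layer ?s j) = card (layer c k \<inter> layer c j)" by (rule causet_iso_card)
    also have "layer c k \<inter> layer c j = layer c j" using layer_mono[OF that, of c] by blast
    also have "card (layer c j) = N j" using causet_iso_card[OF iso[of j]] by simp
    finally show ?thesis .
  qed
  have layer_s: "layer ?s j = {..<N j}" for j
  proof -
    have sub: "{..<N j} \<subseteq> layer ?s j"
      using card_subset_eq[of "{..<N j}" "{..<N j} \<inter> layer ?s j"] card[of j j] by auto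
    have eq: "{..<N k} \<inter> layer ?s j = {..<N j}" if "j \<le> k" for k
      using card_subset_eq[of "{..<N k} \<inter> layer ?s j" "{..<N j}"] card[OF that] sub N[OF that] by auto
    have "x < N j" if "x \<in> layer ?s j" for x
    proof -
      \<comment> \<open>All of \<open>0, ..., x\<close> have height at most \<open>x\<close>, so
        layer \<open>?k\<close> of \<open>c\<close> has more than \<open>x\<close> elements and
        \<open>x < N ?k\<close>.\<close>
      let ?k = "max j (Suc x)"
      have "y \<in> layer c ?k" if "y \<le> x" for y
        by (rule subsetD[OF layer_mono layer_exhausts[OF labeledD(1)[OF c(1)]]]) (use that in auto)
      then have "card {..x} \<le> card (layer c ?k)" by (intro card_mono c(2)) auto
      also have "\<dots> = N ?k" using causet_iso_card[OF iso[of ?k]] by simp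
      finally have "x \<in> {..<N ?k} \<inter> layer ?s j" using that by simp
      then show ?thesis unfolding eq[OF max.cobounded1] by simp
    qed
    with sub show ?thesis by auto
  qed
  show "causet_iso UNIV c UNIV ?s"
  proof (rule causet_iso_of_layers)
    show "causet_iso (layer c j) c (layer ?s j) ?s" for j
      unfolding layer_s by (rule causet_iso_sym[OF iso_s])
  qed (use c lab labeled_layers_UNIV in blast)+
qed

lemma iso_class_canonical_labeling:
  assumes "c \<in> labeled" "\<And>j. finite (layer c j)"
  shows "iso_class (canonical_labeling c) = iso_class c"
  unfolding iso_class_def
  by (rule equiv_class_eq[OF equiv_labeled_iso, symmetric])
     (use assms canonical_labeling_labeled canonical_labeling_iso in \<open>simp add: labeled_iso_def\<close>)

text \<open>Off the causets with finite layers the canonical labeling need not be an order, whence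
  the empty order there.\<close>

lemma measurable_canonical_labeling:
  "(\<lambda>c. if \<forall>j. finite (layer c j) then canonical_labeling c else {})
    \<in> measurable stem_algebra (sigma labeled {cyl n b | n b. b \<in> finite_labeled n})"
    (is "?f \<in> _")
proof (rule measurable_measure_of[OF cylinders_subset])
  have "{} \<in> labeled" by (rule labeledI) (auto simp: trans_def)
  then show f: "?f \<in> space stem_algebra \<rightarrow> labeled" using canonical_labeling_labeled by auto
  fix Y assume "Y \<in> {cyl n b | n b. b \<in> finite_labeled n}"
  then obtain n b where Y: "Y = cyl n b" by blast
  have pred: "Measurable.pred stem_algebra (\<lambda>c. (x, y) \<in> ?f c)" for x y
  proof -
    have "(x, y) \<in> ?f c \<longleftrightarrow> (\<forall>j. finite (layer c j)) \<and> (x, y) \<in> canonical_labeling c" for c by simp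
    then show ?thesis
      by (simp only:) (intro pred_intros_logic pred_finite_layers pred_canonical_labeling)
  qed
  have "Measurable.pred stem_algebra
      (\<lambda>c. \<forall>x y. ((x, y) \<in> ?f c \<and> x < n \<and> y < n) \<longleftrightarrow> (x, y) \<in> b)"
    by (intro pred_intros_countable pred_intros_logic pred measurable_const) auto
  moreover have "?f -` Y \<inter> space stem_algebra =
      {c \<in> space stem_algebra. \<forall>x y. ((x, y) \<in> ?f c \<and> x < n \<and> y < n) \<longleftrightarrow> (x, y) \<in> b}"
    using f unfolding Y cyl_def by (auto simp only: set_eq_iff split_paired_all Pi_iff vimage_def mem_Collect_eq Int_iff mem_Sigma_iff lessThan_iff)
  ultimately show "?f -` Y \<inter> space stem_algebra \<in> sets stem_algebra" by (simp add: pred_def)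
qed

section \<open>Transfer of events along the canonical labeling\<close>

theorem corollary1:
  assumes "A \<in> unlabeled_events"
  shows "\<exists>B \<in> stem_events. \<forall>t. csg_couplings t \<longrightarrow> sym_diff A B \<in> null_sets (csg_measure t)"
proof -
  let ?X = "iso_class -` A \<inter> labeled" and ?G = "{c \<in> labeled. \<forall>j. finite (layer c j)}"
  let ?f = "\<lambda>c. if \<forall>j. finite (layer c j) then canonical_labeling c else {}"
  interpret L: sigma_algebra labeled labeled_events by (rule sigma_algebra_labeled_events)
  interpret U: sigma_algebra unlabeled unlabeled_events by (rule sigma_algebra_unlabeled_events)
  have X: "?X \<in> labeled_events" "A \<subseteq> unlabeled" using assms by (auto simp: unlabeled_events_def)
  have "?f -` ?X \<inter> labeled \<in> sets stem_algebra"
    using measurable_sets[OF measurable_canonical_labeling, of ?X] X(1)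
    by (simp add: labeled_events_def cylinders_subset)
  moreover have "?G \<in> sets stem_algebra" using pred_finite_layers by (simp add: pred_def)
  ultimately have "(?f -` ?X \<inter> labeled) \<inter> ?G \<in> sets stem_algebra" by (rule sets.Int)
  \<comment> \<open>On \<open>?G\<close> the canonical labeling is isomorphic to \<open>c\<close>,
    and \<open>?X\<close> is a union of isomorphism classes, so pulling \<open>?X\<close> back does
    not change it there. The intersection with \<open>?G\<close> removes the default value of
    \<open>?f\<close>.\<close>
  also have "(?f -` ?X \<inter> labeled) \<inter> ?G = ?X \<inter> ?G"
    using canonical_labeling_labeled iso_class_canonical_labeling by auto
  \<comment> \<open>No couplings have entered yet, so \<open>B\<close> serves all of them.\<close>
  finally obtain B where B: "B \<in> stem_events" "?X \<inter> ?G = iso_class -` B \<inter> labeled"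
    unfolding sets_stem_algebra by blast
  have "B \<subseteq> unlabeled"
    using B(1) sigma_sets_into_sp[of "stem_set ` finite_unlabeled" unlabeled]
    by (auto simp: stem_events_def stem_set_def)
  \<comment> \<open>The preimage of \<open>B\<close> is \<open>?X \<inter> ?G\<close>, a labeled
    event, so \<open>B\<close> is measurable for \<open>csg_measure t\<close>.\<close>
  then have BU: "B \<in> unlabeled_events"
    using B(2) L.Int[OF X(1) finite_layers_event] by (simp add: unlabeled_events_def)
  have "sym_diff A B \<in> null_sets (csg_measure t)" if t: "csg_couplings t" for t
  proof (rule null_setsI)
    show sets: "sym_diff A B \<in> sets (csg_measure t)"
      using assms BU by (simp add: sets_csg_measure U.Un U.Diff)
    have "emeasure (csg_measure t) (sym_diff A B) =
        emeasure (csg_labeled_measure t) (iso_class -` sym_diff A B \<inter> labeled)"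
      using iso_class_measurable[of t] sets
      by (simp add: csg_measure_def emeasure_distr sets_csg_labeled_measure)
    \<comment> \<open>As the preimage of \<open>B\<close> is \<open>?X \<inter> ?G\<close>, the two
      events differ only at members of \<open>?X\<close> with an infinite layer.\<close>
    also have "iso_class -` sym_diff A B \<inter> labeled = ?X - ?G"
      using B(2) by blast
    also have "\<dots> = {c \<in> space (csg_labeled_measure t). \<not> (c \<in> ?X \<longrightarrow> (\<forall>j. finite (layer c j)))}"
      by (auto simp: sets_csg_labeled_measure)
    also have "emeasure (csg_labeled_measure t) \<dots> = 0"
      by (rule emeasure_eq_0_AE) (use AE_finite_layers[OF t] in eventually_elim, blast)
    finally show "emeasure (csg_measure t) (sym_diff A B) = 0" .
  qed
  with B(1) show ?thesis by blast
qed

end
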